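(* Let $\Omega=(a_1,b_1)\times\cdots\times(a_n,b_n)\subset\mathbb{R}^n$, $n\ge2$, be a bounded box with admissible mesh size vector $h$, let $a,b:\Omega_h\to\mathbb{R}$, and let $u\in W_0^{1,2}(\overline{\Omega}_h)$ satisfy $$-\Delta_hu=a(x)u+b(x)\ \text{in }\Omega_h,\qquad u=0\ \text{on }\partial\Omega_h.$$ Let $q>\frac n2$ (for $n=2$ additionally choose $\hat n$ with $q>\frac{\hat n}{2}>1$) and $q'=\frac{q}{q-1}$. Then $$\|u\|_\infty\le(2K)^{q'}\|u\|_{L^2}+2K\|b\|_\infty(1+|\Omega|),$$ where $$K=\max\Big\{\frac{n}{(n-2)q'},\ C_S(n)\sqrt2\,\||a|+1\|_{L^q}^{1/2}\Big\}^{\left(\frac{n(q-1)}{2q-n}\right)^2}\quad\text{if }n\ge3,$$ $$K=\max\Big\{\frac{\hat n}{(\hat n-2)q'},\ \frac{4\hat n}{\hat n-2}C_S(2)(1+C_P(\Omega))\sqrt2\,\||a|+1\|_{L^q}^{1/2}\Big\}^{\left(\frac{\hat n(q-1)}{2q-\hat n}\right)^2}\quad\text{if }n=2.$$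
   Context: Admissible mesh: $h_i>0$, $a_i=k_ih_i$, $b_i=l_ih_i$, $k_i,l_i\in\mathbb{Z}$, $l_i-k_i>1$; $\mathbb{R}^n_h=\{(h_1z_1,\dots,h_nz_n):z_i\in\mathbb{Z}\}$, $\overline{\Omega}_h=\overline{\Omega}\cap\mathbb{R}^n_h$, $\Omega_h=\Omega\cap\mathbb{R}^n_h$, $\partial\Omega_h=\partial\Omega\cap\mathbb{R}^n_h$, $\partial_i^+\Omega_h=\partial\Omega_h\cap\{x_i=b_i\}$, $\mathbf{h}=h_1\cdots h_n$, $|\Omega|=\prod_i(b_i-a_i)$. $\Delta_hu(x)=\sum_i\frac{u(x+h_ie_i)-2u(x)+u(x-h_ie_i)}{h_i^2}$, $D_i^+u(x)=(u(x+h_ie_i)-u(x))/h_i$. Norms: $\|v\|_{L^r}=(\sum_x|v(x)|^r\mathbf{h})^{1/r}$ (sum over the domain of $v$), $\|v\|_\infty=\max|v|$, $\|u\|_D^2=\sum_i\sum_{x\in\overline{\Omega}_h\setminus\partial_i^+\Omega_h}|D_i^+u(x)|^2\mathbf{h}$. $W_0^{1,2}(\overline{\Omega}_h)$ = functions on $\overline{\Omega}_h$ vanishing on $\partial\Omega_h$. Constants: $C_S(n)=\frac{4(n-1)}{\sqrt n(n-2)}$ ($n\ge3$), $C_S(2)=8\sqrt{2\pi(e+256)}$; $C_P(\Omega)$ is a Poincaré constant, i.e. $\|v\|_{L^2}\le C_P(\Omega)\|v\|_D$ for all $v\in W_0^{1,2}(\overline{\Omega}_h)$. *)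

theory Defs
  imports Complex_Main
begin

text \<open>Points of R^n are represented as functions nat => real that vanish
  at indices i >= n.  The index set of coordinates is {..<n}.\<close>

type_synonym pt = "nat \<Rightarrow> real"

definition unit_shift :: "pt \<Rightarrow> nat \<Rightarrow> real \<Rightarrow> pt" where
  "unit_shift x i t = x(i := x i + t)"

definition mesh_grid :: "nat \<Rightarrow> (nat \<Rightarrow> real) \<Rightarrow> pt set" where
  "mesh_grid n h = {x. (\<forall>i<n. \<exists>z::int. x i = h i * of_int z) \<and> (\<forall>i. n \<le> i \<longrightarrow> x i = 0)}"

definition admissible_mesh :: "nat \<Rightarrow> (nat \<Rightarrow> real) \<Rightarrow> (nat \<Rightarrow> real) \<Rightarrow> (nat \<Rightarrow> real) \<Rightarrow> bool" where
  "admissible_mesh n lo up h \<longleftrightarrow>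
     (\<forall>i<n. h i > 0 \<and> (\<exists>k l::int. lo i = of_int k * h i \<and> up i = of_int l * h i \<and> l - k > 1))"

definition closed_grid :: "nat \<Rightarrow> (nat \<Rightarrow> real) \<Rightarrow> (nat \<Rightarrow> real) \<Rightarrow> (nat \<Rightarrow> real) \<Rightarrow> pt set" where
  "closed_grid n lo up h = {x \<in> mesh_grid n h. \<forall>i<n. lo i \<le> x i \<and> x i \<le> up i}"

definition open_grid :: "nat \<Rightarrow> (nat \<Rightarrow> real) \<Rightarrow> (nat \<Rightarrow> real) \<Rightarrow> (nat \<Rightarrow> real) \<Rightarrow> pt set" where
  "open_grid n lo up h = {x \<in> mesh_grid n h. \<forall>i<n. lo i < x i \<and> x i < up i}"

definition bdry_grid :: "nat \<Rightarrow> (nat \<Rightarrow> real) \<Rightarrow> (nat \<Rightarrow> real) \<Rightarrow> (nat \<Rightarrow> real) \<Rightarrow> pt set" where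
  "bdry_grid n lo up h = closed_grid n lo up h - open_grid n lo up h"

definition top_face :: "nat \<Rightarrow> (nat \<Rightarrow> real) \<Rightarrow> (nat \<Rightarrow> real) \<Rightarrow> (nat \<Rightarrow> real) \<Rightarrow> nat \<Rightarrow> pt set" where
  "top_face n lo up h i = {x \<in> bdry_grid n lo up h. x i = up i}"

definition cell_vol :: "nat \<Rightarrow> (nat \<Rightarrow> real) \<Rightarrow> real" where
  "cell_vol n h = (\<Prod>i<n. h i)"

definition box_vol :: "nat \<Rightarrow> (nat \<Rightarrow> real) \<Rightarrow> (nat \<Rightarrow> real) \<Rightarrow> real" where
  "box_vol n lo up = (\<Prod>i<n. up i - lo i)"

definition disc_laplace :: "nat \<Rightarrow> (nat \<Rightarrow> real) \<Rightarrow> (pt \<Rightarrow> real) \<Rightarrow> pt \<Rightarrow> real" where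
  "disc_laplace n h u x =
     (\<Sum>i<n. (u (unit_shift x i (h i)) - 2 * u x + u (unit_shift x i (- h i))) / (h i)^2)"

definition fwd_diff :: "(nat \<Rightarrow> real) \<Rightarrow> (pt \<Rightarrow> real) \<Rightarrow> nat \<Rightarrow> pt \<Rightarrow> real" where
  "fwd_diff h u i x = (u (unit_shift x i (h i)) - u x) / h i"

definition Lr_norm :: "nat \<Rightarrow> (nat \<Rightarrow> real) \<Rightarrow> real \<Rightarrow> pt set \<Rightarrow> (pt \<Rightarrow> real) \<Rightarrow> real" where
  "Lr_norm n h r S v = (\<Sum>x\<in>S. \<bar>v x\<bar> powr r * cell_vol n h) powr (1 / r)"

definition sup_norm :: "pt set \<Rightarrow> (pt \<Rightarrow> real) \<Rightarrow> real" where
  "sup_norm S v = Max ((\<lambda>x. \<bar>v x\<bar>) ` S)"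

definition D_norm :: "nat \<Rightarrow> (nat \<Rightarrow> real) \<Rightarrow> (nat \<Rightarrow> real) \<Rightarrow> (nat \<Rightarrow> real) \<Rightarrow> (pt \<Rightarrow> real) \<Rightarrow> real" where
  "D_norm n lo up h u =
     sqrt (\<Sum>i<n. \<Sum>x\<in>closed_grid n lo up h - top_face n lo up h i.
              \<bar>fwd_diff h u i x\<bar>^2 * cell_vol n h)"

definition W012 :: "nat \<Rightarrow> (nat \<Rightarrow> real) \<Rightarrow> (nat \<Rightarrow> real) \<Rightarrow> (nat \<Rightarrow> real) \<Rightarrow> (pt \<Rightarrow> real) \<Rightarrow> bool" where
  "W012 n lo up h v \<longleftrightarrow> (\<forall>x\<in>bdry_grid n lo up h. v x = 0)"

definition is_poincare_const :: "nat \<Rightarrow> (nat \<Rightarrow> real) \<Rightarrow> (nat \<Rightarrow> real) \<Rightarrow> (nat \<Rightarrow> real) \<Rightarrow> real \<Rightarrow> bool" where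
  "is_poincare_const n lo up h C \<longleftrightarrow>
     (\<forall>v. W012 n lo up h v \<longrightarrow>
        Lr_norm n h 2 (closed_grid n lo up h) v \<le> C * D_norm n lo up h v)"

definition C_S :: "nat \<Rightarrow> real" where
  "C_S n = (if n = 2 then 8 * sqrt (2 * pi * (exp 1 + 256))
            else 4 * (real n - 1) / (sqrt (real n) * (real n - 2)))"

end

theory Submission
  imports Defs "HOL-Analysis.Convex"
begin

text \<open>Moser iteration. Testing the equation with \<open>sgn u * \<bar>u\<bar> powr (2 * p - 1)\<close> bounds \<open>\<bar>u\<bar> powr p\<close> in
  the \<open>D\<close>-norm, and a discrete Sobolev inequality turns this into
  \<open>N (j + 1) \<le> (m * \<chi> ^ j) powr (1 / \<chi> ^ j) * N j\<close>, where \<open>N j\<close> is the maximum of the \<open>L\<^sup>r\<close>-norm of \<open>u\<close>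
  for \<open>r = 2 * q' * \<chi> ^ j\<close> and of \<open>\<parallel>b\<parallel> * (1 + \<bar>\<Omega>\<bar>)\<close>. Taking a maximum rather than a sum costs only the
  factor \<open>\<surd>2\<close> that appears in \<open>K\<close>. The product of all factors is at most \<open>K\<close> since \<open>m \<ge> \<chi>\<close> and
  \<open>\<Sum>j. (j + 1) / \<chi> ^ j = (\<chi> / (\<chi> - 1))\<^sup>2\<close>, and the norm for \<open>r = 2 * q'\<close> at the start of the iteration is
  interpolated between \<open>L\<^sup>2\<close> and the maximum norm. The Sobolev inequality follows from Loomis--Whitney,
  as in the continuous proof of Gagliardo and Nirenberg.\<close>

subsection \<open>Elementary inequalities\<close>

text \<open>The bound \<open>ln t \<le> t - 1\<close> is applied to \<open>t = x j / m\<close>,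
  where \<open>m\<close> is the weighted arithmetic mean. Averaging with the weights makes the
  right-hand side vanish, so the weighted mean of \<open>ln (x j)\<close> is at most
  \<open>ln m\<close>, and it remains to exponentiate.\<close>

lemma weighted_am_gm:
  fixes x w :: "'a \<Rightarrow> real"
  assumes fin: "finite J" and w: "\<And>j. j \<in> J \<Longrightarrow> w j \<ge> 0" and w1: "sum w J = 1"
    and x: "\<And>j. j \<in> J \<Longrightarrow> x j \<ge> 0"
  shows "(\<Prod>j\<in>J. x j powr w j) \<le> (\<Sum>j\<in>J. w j * x j)"
proof (cases "\<exists>j\<in>J. x j = 0")
  case True
  \<comment> \<open>\<open>0 powr w = 0\<close> for every exponent, including \<open>w = 0\<close>,
    so a single zero kills the product even if its weight is zero.\<close>
  then have "(\<Prod>j\<in>J. x j powr w j) = 0"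
    using fin by (intro prod_zero) auto
  then show ?thesis
    using w x by (simp add: sum_nonneg)
next
  case False
  then have pos: "x j > 0" if "j \<in> J" for j
    using x that by force
  define m where "m = (\<Sum>j\<in>J. w j * x j)"
  have "m \<ge> 0"
    unfolding m_def using w x by (simp add: sum_nonneg)
  moreover have "m \<noteq> 0"
  proof
    assume "m = 0"
    then have "\<forall>j\<in>J. w j * x j = 0"
      unfolding m_def using sum_nonneg_eq_0_iff[OF fin, of "\<lambda>j. w j * x j"] w x by simp
    then have "sum w J = 0"
      using pos by (intro sum.neutral) force
    with w1 show False by simp
  qed
  ultimately have m: "m > 0" by simp
  have "(\<Sum>j\<in>J. w j * (ln (x j) - ln m)) \<le> (\<Sum>j\<in>J. w j * (x j / m - 1))"
  proof (intro sum_mono mult_left_mono w)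
    fix j assume "j \<in> J"
    then show "ln (x j) - ln m \<le> x j / m - 1"
      using ln_le_minus_one[of "x j / m"] pos[of j] m by (simp add: ln_div)
  qed
  also have "\<dots> = (\<Sum>j\<in>J. w j * x j) / m - sum w J"
    by (simp add: right_diff_distrib sum_subtractf sum_divide_distrib)
  also have "\<dots> = 0"
    using m w1 by (simp flip: m_def)
  finally have "(\<Sum>j\<in>J. w j * ln (x j)) \<le> sum w J * ln m"
    by (simp add: right_diff_distrib sum_subtractf sum_distrib_right)
  then have "exp (\<Sum>j\<in>J. w j * ln (x j)) \<le> m"
    using m w1 by (metis exp_le_cancel_iff exp_ln mult_1)
  moreover have "exp (\<Sum>j\<in>J. w j * ln (x j)) = (\<Prod>j\<in>J. x j powr w j)"
    unfolding exp_sum[OF fin]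
  proof (rule prod.cong[OF refl])
    fix j assume "j \<in> J"
    then show "exp (w j * ln (x j)) = x j powr w j"
      using pos[of j] by (simp add: powr_def)
  qed
  ultimately show ?thesis
    by (simp add: m_def)
qed

text \<open>Both sides scale alike in each \<open>G j\<close>, so every \<open>G j\<close> is
  normalised to total mass 1 over \<open>T\<close>. The pointwise \<open>weighted_am_gm\<close> then
  sums to \<open>sum w J = 1\<close>. A \<open>G j\<close> of mass zero vanishes on \<open>T\<close>
  and is treated first.\<close>

lemma Hoelder_sum_prod:
  fixes G :: "'a \<Rightarrow> 'b \<Rightarrow> real"
  assumes fin: "finite J" and finT: "finite T" and w: "\<And>j. j \<in> J \<Longrightarrow> w j \<ge> 0"
    and w1: "sum w J = 1" and G: "\<And>j t. j \<in> J \<Longrightarrow> t \<in> T \<Longrightarrow> G j t \<ge> 0"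
  shows "(\<Sum>t\<in>T. \<Prod>j\<in>J. G j t powr w j) \<le> (\<Prod>j\<in>J. (\<Sum>t\<in>T. G j t) powr w j)"
proof (cases "\<exists>j\<in>J. (\<Sum>t\<in>T. G j t) = 0")
  case True
  then obtain j where j: "j \<in> J" "(\<Sum>t\<in>T. G j t) = 0" by blast
  then have "\<forall>t\<in>T. G j t = 0"
    using sum_nonneg_eq_0_iff[OF finT, of "G j"] G by simp
  then have "(\<Prod>j\<in>J. G j t powr w j) = 0" if "t \<in> T" for t
    using j fin that by (intro prod_zero) auto
  then show ?thesis
    by (simp add: prod_nonneg)
next
  case False
  define s where "s j = (\<Sum>t\<in>T. G j t)" for j
  have s: "s j > 0" if "j \<in> J" for j
    using False that G sum_nonneg[of T "G j"] by (force simp: s_def)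
  have "(\<Sum>t\<in>T. \<Prod>j\<in>J. (G j t / s j) powr w j) \<le> (\<Sum>t\<in>T. \<Sum>j\<in>J. w j * (G j t / s j))"
  proof (intro sum_mono weighted_am_gm fin w w1)
    fix t j assume "t \<in> T" "j \<in> J"
    then show "0 \<le> G j t / s j" using s[of j] G[of j t] by simp
  qed
  also have "\<dots> = (\<Sum>j\<in>J. w j * ((\<Sum>t\<in>T. G j t) / s j))"
    by (subst sum.swap) (simp add: sum_distrib_left sum_divide_distrib)
  also have "\<dots> = (\<Sum>j\<in>J. w j)"
  proof (rule sum.cong[OF refl])
    fix j assume "j \<in> J"
    then show "w j * ((\<Sum>t\<in>T. G j t) / s j) = w j"
      using s[of j] by (simp flip: s_def)
  qed
  finally have 1: "(\<Sum>t\<in>T. \<Prod>j\<in>J. (G j t / s j) powr w j) \<le> 1"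
    using w1 by simp
  have "(\<Prod>j\<in>J. G j t powr w j) = (\<Prod>j\<in>J. (G j t / s j) powr w j) * (\<Prod>j\<in>J. s j powr w j)" for t
    unfolding prod.distrib[symmetric]
  proof (rule prod.cong[OF refl])
    fix j assume "j \<in> J"
    then show "G j t powr w j = (G j t / s j) powr w j * s j powr w j"
      using s[of j] by (simp add: powr_divide)
  qed
  then have "(\<Sum>t\<in>T. \<Prod>j\<in>J. G j t powr w j)
      = (\<Sum>t\<in>T. \<Prod>j\<in>J. (G j t / s j) powr w j) * (\<Prod>j\<in>J. s j powr w j)"
    by (simp add: sum_distrib_right)
  also have "\<dots> \<le> 1 * (\<Prod>j\<in>J. s j powr w j)"
    using 1 by (intro mult_right_mono prod_nonneg) auto
  finally show ?thesis by (simp add: s_def)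
qed

lemma Hoelder_sum:
  fixes F G :: "'b \<Rightarrow> real"
  assumes T: "finite T" and "\<alpha> \<ge> 0" "\<beta> \<ge> 0" "\<alpha> + \<beta> = 1"
    and "\<And>t. t \<in> T \<Longrightarrow> F t \<ge> 0" "\<And>t. t \<in> T \<Longrightarrow> G t \<ge> 0"
  shows "(\<Sum>t\<in>T. F t powr \<alpha> * G t powr \<beta>) \<le> (\<Sum>t\<in>T. F t) powr \<alpha> * (\<Sum>t\<in>T. G t) powr \<beta>"
proof -
  \<comment> \<open>The two-element type \<open>bool\<close> serves as the index set of the two
    factors.\<close>
  have "(\<Sum>t\<in>T. \<Prod>j\<in>UNIV. (if j then F t else G t) powr (if j then \<alpha> else \<beta>))
      \<le> (\<Prod>j\<in>UNIV. (\<Sum>t\<in>T. if j then F t else G t) powr (if j then \<alpha> else \<beta>))"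
    by (rule Hoelder_sum_prod) (use assms in \<open>auto simp: UNIV_bool\<close>)
  then show ?thesis
    by (simp add: UNIV_bool mult.commute)
qed

text \<open>Mean value theorem: the slope at the intermediate point is increasing in that point
  because \<open>\<gamma> \<ge> 1\<close>, so the larger endpoint bounds it. The maximum keeps the
  bound symmetric in \<open>s\<close> and \<open>t\<close>.\<close>

lemma abs_powr_diff_le:
  fixes s t :: real
  assumes "s \<ge> 0" "t \<ge> 0" "\<gamma> \<ge> 1"
  shows "\<bar>s powr \<gamma> - t powr \<gamma>\<bar> \<le> \<gamma> * max s t powr (\<gamma> - 1) * \<bar>s - t\<bar>"
proof -
  have main: "s powr \<gamma> - t powr \<gamma> \<le> \<gamma> * s powr (\<gamma> - 1) * (s - t)"
    if st: "0 \<le> t" "t < s" for s t :: real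
  proof -
    have "continuous_on {t..s} (\<lambda>x. x powr \<gamma>)"
      using assms(3) st by (intro continuous_on_powr' continuous_intros) auto
    moreover have "(\<lambda>x. x powr \<gamma>) differentiable (at x)" if "t < x" "x < s" for x
      using has_real_derivative_powr[of x \<gamma>] that st
      by (auto simp: real_differentiable_def)
    ultimately obtain l z where z: "t < z" "z < s" "DERIV (\<lambda>x. x powr \<gamma>) z :> l"
      "s powr \<gamma> - t powr \<gamma> = (s - t) * l"
      using MVT[OF st(2)] by metis
    then have "l = \<gamma> * z powr (\<gamma> - 1)"
      using has_real_derivative_powr[of z \<gamma>] st DERIV_unique by fastforce
    moreover have "z powr (\<gamma> - 1) \<le> s powr (\<gamma> - 1)"
      using z st assms(3) by (intro powr_mono2) auto
    ultimately have "l \<le> \<gamma> * s powr (\<gamma> - 1)"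
      using assms(3) by (simp add: mult_left_mono)
    then have "(s - t) * l \<le> (s - t) * (\<gamma> * s powr (\<gamma> - 1))"
      using st by (intro mult_left_mono) auto
    then show ?thesis
      using z(4) by (simp add: mult_ac)
  qed
  have mono: "x powr \<gamma> \<le> y powr \<gamma>" if "0 \<le> x" "x \<le> y" for x y :: real
    using that assms(3) by (intro powr_mono2) auto
  consider "s = t" | "t < s" | "s < t" by linarith
  then show ?thesis
  proof cases
    case 2
    then show ?thesis using main[of t s] mono[of t s] assms by (simp add: max_def)
  next
    case 3
    then show ?thesis using main[of s t] mono[of s t] assms by (simp add: max_def)
  qed simp
qed

text \<open>Discrete substitute for the chain rule that compares the gradient of a power
  \<open>p\<close> with the product of the gradients of the powers 1 and \<open>2 * p - 1\<close>.
  For \<open>t \<le> s\<close> one factor of the square is bounded by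
  \<open>p * s powr (p - 1) * (s - t)\<close>; multiplying \<open>s powr (p - 1)\<close> into the
  other gives at most the difference of the powers \<open>2 * p - 1\<close>.\<close>

lemma powr_chord_ineq:
  fixes s t :: real
  assumes "s \<ge> 0" "t \<ge> 0" "p \<ge> 1"
  shows "(s powr p - t powr p)\<^sup>2 \<le> p * ((s - t) * (s powr (2 * p - 1) - t powr (2 * p - 1)))"
proof -
  have main: "(s powr p - t powr p)\<^sup>2 \<le> p * ((s - t) * (s powr (2 * p - 1) - t powr (2 * p - 1)))"
    if st: "0 \<le> t" "t \<le> s" for s t :: real
  proof -
    have le: "t powr p \<le> s powr p"
      using st assms(3) by (intro powr_mono2) auto
    have "s powr (p - 1) * (s powr p - t powr p) \<le> s powr (2 * p - 1) - t powr (2 * p - 1)"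
    proof -
      have "t powr (p - 1) \<le> s powr (p - 1)"
        using st assms(3) by (intro powr_mono2) auto
      then have "t powr (p - 1) * t powr p \<le> s powr (p - 1) * t powr p"
        by (intro mult_right_mono) auto
      moreover have "x powr (2 * p - 1) = x powr (p - 1) * x powr p" for x :: real
        by (simp flip: powr_add)
      ultimately show ?thesis
        by (simp add: algebra_simps)
    qed
    then have "p * (s - t) * (s powr (p - 1) * (s powr p - t powr p))
        \<le> p * (s - t) * (s powr (2 * p - 1) - t powr (2 * p - 1))"
      using st assms(3) by (intro mult_left_mono) auto
    moreover have "(s powr p - t powr p)\<^sup>2
        \<le> p * s powr (p - 1) * (s - t) * (s powr p - t powr p)"
      unfolding power2_eq_square
      using abs_powr_diff_le[of s t p] st le assms(3)
      by (intro mult_right_mono) (auto simp: max_def)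
    ultimately show ?thesis
      by (simp add: mult_ac)
  qed
  show ?thesis
  proof (cases "t \<le> s")
    case True
    then show ?thesis using main assms by blast
  next
    case False
    then have "(t powr p - s powr p)\<^sup>2 \<le> p * ((t - s) * (t powr (2 * p - 1) - s powr (2 * p - 1)))"
      using main[of s t] assms by simp
    then show ?thesis
      by (simp add: power2_commute algebra_simps)
  qed
qed

text \<open>With the odd function \<open>\<phi>\<close>, passing to absolute values leaves the
  diagonal terms \<open>s * \<phi> s\<close> unchanged and can only enlarge the subtracted cross
  terms, so the nonnegative case suffices.\<close>

lemma signed_powr_chord_ineq:
  fixes s t :: real
  assumes p: "p \<ge> 1"
  shows "(\<bar>s\<bar> powr p - \<bar>t\<bar> powr p)\<^sup>2
    \<le> p * ((s - t) * (sgn s * \<bar>s\<bar> powr (2 * p - 1) - sgn t * \<bar>t\<bar> powr (2 * p - 1)))"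
proof -
  define \<phi> where "\<phi> s = sgn s * \<bar>s\<bar> powr (2 * p - 1)" for s :: real
  have abs\<phi>: "\<bar>\<phi> s\<bar> = \<bar>s\<bar> powr (2 * p - 1)" for s
    by (cases "s = 0") (simp_all add: \<phi>_def abs_mult)
  have diag: "s * \<phi> s = \<bar>s\<bar> * \<bar>\<phi> s\<bar>" for s
    unfolding abs\<phi> by (simp add: \<phi>_def abs_sgn mult_ac)
  have "s * \<phi> t \<le> \<bar>s\<bar> * \<bar>\<phi> t\<bar>" "t * \<phi> s \<le> \<bar>t\<bar> * \<bar>\<phi> s\<bar>"
    by (metis abs_ge_self abs_mult)+
  then have "(\<bar>s\<bar> - \<bar>t\<bar>) * (\<bar>\<phi> s\<bar> - \<bar>\<phi> t\<bar>) \<le> (s - t) * (\<phi> s - \<phi> t)"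
    using diag[of s] diag[of t] by (simp add: algebra_simps)
  then have "p * ((\<bar>s\<bar> - \<bar>t\<bar>) * (\<bar>\<phi> s\<bar> - \<bar>\<phi> t\<bar>)) \<le> p * ((s - t) * (\<phi> s - \<phi> t))"
    using p by (intro mult_left_mono) auto
  moreover have "(\<bar>s\<bar> powr p - \<bar>t\<bar> powr p)\<^sup>2 \<le> p * ((\<bar>s\<bar> - \<bar>t\<bar>) * (\<bar>\<phi> s\<bar> - \<bar>\<phi> t\<bar>))"
    unfolding abs\<phi> using p by (intro powr_chord_ineq) auto
  ultimately have "(\<bar>s\<bar> powr p - \<bar>t\<bar> powr p)\<^sup>2 \<le> p * ((s - t) * (\<phi> s - \<phi> t))"
    by (rule order_trans[rotated])
  then show ?thesis
    by (simp only: \<phi>_def)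
qed

lemma Cauchy_Schwarz_sqrt:
  fixes f g :: "'a \<Rightarrow> real"
  shows "(\<Sum>x\<in>A. f x * g x) \<le> sqrt (\<Sum>x\<in>A. (f x)\<^sup>2) * sqrt (\<Sum>x\<in>A. (g x)\<^sup>2)"
  using Cauchy_Schwarz_ineq_sum[of f g A]
  by (metis abs_le_D1 real_sqrt_abs real_sqrt_le_iff real_sqrt_mult)

text \<open>Since \<open>\<chi> \<le> m\<close>, each base \<open>m * \<chi> ^ i\<close> is at most
  \<open>m ^ (i + 1)\<close>. The exponents of \<open>m\<close> then add up to a partial sum of the
  differentiated geometric series at \<open>1 / \<chi>\<close>.\<close>

lemma prod_powr_geometric_le:
  fixes m \<chi> :: real
  assumes \<chi>: "\<chi> > 1" and m: "m \<ge> \<chi>"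
  shows "(\<Prod>i<j. (m * \<chi> ^ i) powr (1 / \<chi> ^ i)) \<le> m powr ((\<chi> / (\<chi> - 1))\<^sup>2)"
proof -
  have m1: "m > 1" using assms by linarith
  have "(\<Prod>i<j. (m * \<chi> ^ i) powr (1 / \<chi> ^ i)) \<le> (\<Prod>i<j. m powr (real (Suc i) * (1 / \<chi>) ^ i))"
  proof (intro prod_mono conjI)
    fix i
    have "m * \<chi> ^ i \<le> m * m ^ i"
      using assms by (intro mult_left_mono power_mono) auto
    then have "(m * \<chi> ^ i) powr (1 / \<chi> ^ i) \<le> (m powr real (Suc i)) powr (1 / \<chi> ^ i)"
      using m1 \<chi> by (intro powr_mono2) (auto simp: powr_realpow simp del: of_nat_Suc)
    then show "(m * \<chi> ^ i) powr (1 / \<chi> ^ i) \<le> m powr (real (Suc i) * (1 / \<chi>) ^ i)"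
      by (simp add: powr_powr power_one_over)
  qed auto
  also have "\<dots> = m powr (\<Sum>i<j. real (Suc i) * (1 / \<chi>) ^ i)"
    using m1 by (subst powr_sum) auto
  also have "\<dots> \<le> m powr (1 / (1 - 1 / \<chi>)\<^sup>2)"
  proof (intro powr_mono)
    have s: "(\<lambda>i. real (Suc i) * (1 / \<chi>) ^ i) sums (1 / (1 - 1 / \<chi>)\<^sup>2)"
      using geometric_deriv_sums[of "1 / \<chi>"] \<chi> by simp
    have "(\<Sum>i<j. real (Suc i) * (1 / \<chi>) ^ i) \<le> (\<Sum>i. real (Suc i) * (1 / \<chi>) ^ i)"
      using \<chi> by (intro sum_le_suminf sums_summable[OF s]) auto
    with s show "(\<Sum>i<j. real (Suc i) * (1 / \<chi>) ^ i) \<le> 1 / (1 - 1 / \<chi>)\<^sup>2"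
      by (simp add: sums_iff)
  qed (use m1 in auto)
  also have "1 / (1 - 1 / \<chi>)\<^sup>2 = (\<chi> / (\<chi> - 1))\<^sup>2"
    using \<chi> by (simp add: power_divide field_simps power2_eq_square)
  finally show ?thesis .
qed

subsection \<open>The Loomis--Whitney inequality on finite grids\<close>

text \<open>Coordinates outside \<open>S\<close> are frozen at those of \<open>x\<close> rather than
  dropped, so all slabs consist of points of the same type and fixing one more coordinate is a
  function update.\<close>

definition slab :: "('a \<Rightarrow> 'b set) \<Rightarrow> 'a set \<Rightarrow> ('a \<Rightarrow> 'b) \<Rightarrow> ('a \<Rightarrow> 'b) set" where
  "slab I S x = {y. (\<forall>i\<in>S. y i \<in> I i) \<and> (\<forall>i. i \<notin> S \<longrightarrow> y i = x i)}"

lemma slab_empty [simp]: "slab I {} x = {x}"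
  by (auto simp: slab_def)

text \<open>Changing a frozen coordinate translates the slab bijectively; this brings sums over
  parallel slabs to a common index set.\<close>

lemma slab_upd:
  assumes "i \<notin> S"
  shows "slab I S (x(i := t)) = (\<lambda>y. y(i := t)) ` slab I S x"
    and "inj_on (\<lambda>y. y(i := t)) (slab I S x)"
proof -
  show "slab I S (x(i := t)) = (\<lambda>y. y(i := t)) ` slab I S x"
  proof (intro set_eqI iffI)
    fix y assume y: "y \<in> slab I S (x(i := t))"
    then have "y = (y(i := x i))(i := t)" "y(i := x i) \<in> slab I S x"
      using assms by (auto simp: slab_def)
    then show "y \<in> (\<lambda>y. y(i := t)) ` slab I S x" by blast
  qed (use assms in \<open>auto simp: slab_def\<close>)
  show "inj_on (\<lambda>y. y(i := t)) (slab I S x)"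
  proof (rule inj_onI)
    fix y z assume yz: "y \<in> slab I S x" "z \<in> slab I S x" "y(i := t) = z(i := t)"
    show "y = z"
    proof
      fix j show "y j = z j"
        using yz(1,2) assms fun_cong[OF yz(3), of j] by (cases "j = i") (simp_all add: slab_def)
    qed
  qed
qed

lemma sum_slab_upd:
  assumes "i \<notin> S"
  shows "sum F (slab I S (x(i := t))) = (\<Sum>y\<in>slab I S x. F (y(i := t)))"
  by (simp add: slab_upd(1)[OF assms] sum.reindex[OF slab_upd(2)[OF assms]])

lemma slab_insert:
  assumes "i \<notin> S"
  shows "slab I (insert i S) x = (\<Union>t\<in>I i. slab I S (x(i := t)))"
proof (intro set_eqI iffI)
  fix y assume y: "y \<in> slab I (insert i S) x"
  then have "y i \<in> I i" "y \<in> slab I S (x(i := y i))"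
    by (auto simp: slab_def)
  then show "y \<in> (\<Union>t\<in>I i. slab I S (x(i := t)))" by blast
qed (use assms in \<open>auto simp: slab_def split: if_splits\<close>)

lemma finite_slab:
  assumes "finite S" "\<And>i. i \<in> S \<Longrightarrow> finite (I i)"
  shows "finite (slab I S x)"
  using assms by (induction S arbitrary: x rule: finite_induct) (auto simp: slab_insert)

lemma sum_slab_insert:
  assumes S: "finite S" "i \<notin> S" "\<And>j. j \<in> insert i S \<Longrightarrow> finite (I j)"
  shows "sum F (slab I (insert i S) x) = (\<Sum>t\<in>I i. sum F (slab I S (x(i := t))))"
  unfolding slab_insert[OF S(2)]
proof (rule sum.UNION_disjoint)
  show "\<forall>t\<in>I i. finite (slab I S (x(i := t)))"
    using S by (auto intro: finite_slab)
  show "\<forall>s\<in>I i. \<forall>t\<in>I i. s \<noteq> t \<longrightarrow> slab I S (x(i := s)) \<inter> slab I S (x(i := t)) = {}"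
  proof (intro ballI impI)
    fix s t assume "s \<in> I i" "t \<in> I i" "s \<noteq> t"
    have "y i = s" if "y \<in> slab I S (x(i := s))" for y s
      using that S(2) by (auto simp: slab_def)
    with \<open>s \<noteq> t\<close> show "slab I S (x(i := s)) \<inter> slab I S (x(i := t)) = {}" by blast
  qed
qed (use S in auto)

text \<open>Fubini with the new coordinate innermost, so that the inner sums run along single grid
  lines.\<close>

lemma sum_slab_insert':
  assumes "finite S" "i \<notin> S" "\<And>j. j \<in> insert i S \<Longrightarrow> finite (I j)"
  shows "sum F (slab I (insert i S) x) = (\<Sum>y\<in>slab I S x. \<Sum>t\<in>I i. F (y(i := t)))"
proof -
  have "sum F (slab I (insert i S) x) = (\<Sum>t\<in>I i. sum F (slab I S (x(i := t))))"
    using assms by (intro sum_slab_insert) auto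
  also have "\<dots> = (\<Sum>t\<in>I i. \<Sum>y\<in>slab I S x. F (y(i := t)))"
    by (simp add: sum_slab_upd[OF assms(2)])
  also have "\<dots> = (\<Sum>y\<in>slab I S x. \<Sum>t\<in>I i. F (y(i := t)))"
    by (rule sum.swap)
  finally show ?thesis .
qed

lemma card_slab:
  assumes "finite S" "\<And>i. i \<in> S \<Longrightarrow> finite (I i)"
  shows "card (slab I S x) = (\<Prod>i\<in>S. card (I i))"
  using assms
proof (induction S arbitrary: x rule: finite_induct)
  case (insert i S)
  have "card (slab I (insert i S) x) = (\<Sum>t\<in>I i. card (slab I S (x(i := t))))"
    using sum_slab_insert[of S i I "\<lambda>_. 1::nat" x] insert by simp
  also have "\<dots> = card (I i) * (\<Prod>i\<in>S. card (I i))"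
    using insert by simp
  finally show ?case
    using insert by simp
qed simp

text \<open>Each step of the induction sums over one more coordinate \<open>i\<close>: the factor \<open>F i\<close> is constant
  in that direction, and the remaining \<open>card J - 1\<close> factors are handled by Hoelder's inequality.\<close>

lemma Loomis_Whitney:
  fixes F :: "'a \<Rightarrow> ('a \<Rightarrow> 'b) \<Rightarrow> real"
  assumes J: "finite J" "2 \<le> card J" and S: "S \<subseteq> J"
    and I: "\<And>j. j \<in> J \<Longrightarrow> finite (I j)"
    and F0: "\<And>j x. j \<in> J \<Longrightarrow> F j x \<ge> 0"
    and F: "\<And>j x t. j \<in> J \<Longrightarrow> F j (x(j := t)) = F j x"
  shows "(\<Sum>y\<in>slab I S x. \<Prod>j\<in>J. F j y powr (1 / (real (card J) - 1)))
      \<le> (\<Prod>j\<in>J. (sum (F j) (slab I (S - {j}) x)) powr (1 / (real (card J) - 1)))"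
  using finite_subset[OF S J(1)] S
proof (induction S arbitrary: x rule: finite_induct)
  case (insert i S)
  define w where "w = 1 / (real (card J) - 1)"
  define G where "G j t = sum (F j) (slab I (S - {j}) (x(i := t)))" for j t
  have iJ: "i \<in> J" and SJ: "S \<subseteq> J" using insert.prems by auto
  have fin: "finite (I j)" if "j \<in> insert i S" for j
    using that insert.prems I by blast
  have Gi: "G i t = sum (F i) (slab I S x)" for t
    using insert.hyps F[OF iJ] by (simp add: G_def sum_slab_upd)
  have Gj: "(\<Sum>t\<in>I i. G j t) = sum (F j) (slab I (insert i S - {j}) x)" if "j \<in> J - {i}" for j
  proof -
    have "insert i S - {j} = insert i (S - {j})" using that by auto
    moreover have "sum (F j) (slab I (insert i (S - {j})) x) = (\<Sum>t\<in>I i. G j t)"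
      unfolding G_def using insert.hyps fin by (intro sum_slab_insert) auto
    ultimately show ?thesis by simp
  qed
  have G0: "G j t \<ge> 0" if "j \<in> J" for j t
    using F0 that by (simp add: G_def sum_nonneg)
  have w0: "w \<ge> 0"
    using J by (simp add: w_def)
  \<comment> \<open>The exponent is dictated by this: the \<open>card J - 1\<close> factors that
    vary with coordinate \<open>i\<close> must carry Hoelder weights of sum 1.\<close>
  have w1: "sum (\<lambda>_. w) (J - {i}) = 1"
    using J iJ by (simp add: w_def of_nat_diff)
  have "(\<Sum>y\<in>slab I (insert i S) x. \<Prod>j\<in>J. F j y powr w)
      = (\<Sum>t\<in>I i. \<Sum>y\<in>slab I S (x(i := t)). \<Prod>j\<in>J. F j y powr w)"
    using insert.hyps fin by (intro sum_slab_insert) auto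
  also have "\<dots> \<le> (\<Sum>t\<in>I i. \<Prod>j\<in>J. G j t powr w)"
    unfolding G_def w_def using insert.IH[OF SJ] by (intro sum_mono)
  also have "\<dots> = (\<Sum>t\<in>I i. sum (F i) (slab I S x) powr w * (\<Prod>j\<in>J - {i}. G j t powr w))"
    using J iJ by (simp add: prod.remove[of J i] Gi)
  also have "\<dots> = sum (F i) (slab I S x) powr w * (\<Sum>t\<in>I i. \<Prod>j\<in>J - {i}. G j t powr w)"
    by (simp add: sum_distrib_left)
  also have "\<dots> \<le> sum (F i) (slab I S x) powr w * (\<Prod>j\<in>J - {i}. (\<Sum>t\<in>I i. G j t) powr w)"
    using J G0 w0 w1 I[OF iJ] by (intro mult_left_mono Hoelder_sum_prod) auto
  also have "\<dots> = sum (F i) (slab I (insert i S - {i}) x) powr w *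
      (\<Prod>j\<in>J - {i}. sum (F j) (slab I (insert i S - {j}) x) powr w)"
    using Gj insert.hyps by simp
  also have "\<dots> = (\<Prod>j\<in>J. sum (F j) (slab I (insert i S - {j}) x) powr w)"
    using J iJ by (simp add: prod.remove[of J i])
  finally show ?case by (simp add: w_def)
qed simp

subsection \<open>The grid\<close>

locale box_mesh =
  fixes n :: nat and lo up h :: "nat \<Rightarrow> real"
  assumes mesh: "admissible_mesh n lo up h"
begin

abbreviation "C \<equiv> closed_grid n lo up h"
abbreviation "Om \<equiv> open_grid n lo up h"
abbreviation "H \<equiv> cell_vol n h"
abbreviation "base i \<equiv> C - top_face n lo up h i"

definition nodes :: "nat \<Rightarrow> real set" where
  "nodes i = {t. (\<exists>z::int. t = h i * of_int z) \<and> lo i \<le> t \<and> t \<le> up i}"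

lemma h_pos: "i < n \<Longrightarrow> h i > 0"
  using mesh by (simp add: admissible_mesh_def)

lemma H_pos: "H > 0"
  unfolding cell_vol_def using h_pos by (intro prod_pos) auto

text \<open>Integer coordinates reduce the one-dimensional facts about \<open>nodes\<close> to facts
  about the interval \<open>{k..l}\<close>.\<close>

lemma mesh_bounds:
  assumes "i < n"
  obtains k l :: int where "lo i = h i * of_int k" "up i = h i * of_int l" "l - k > 1"
    "nodes i = (\<lambda>z. h i * of_int z) ` {k..l}"
proof -
  obtain k l :: int where kl: "lo i = h i * of_int k" "up i = h i * of_int l" "l - k > 1"
    using mesh assms by (auto simp: admissible_mesh_def mult.commute)
  have "nodes i = (\<lambda>z. h i * of_int z) ` {k..l}"
    using h_pos[OF assms] by (auto simp: nodes_def kl)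
  with kl show ?thesis using that by blast
qed

lemma finite_nodes: "i < n \<Longrightarrow> finite (nodes i)"
  by (rule mesh_bounds[of i]) auto

text \<open>Dropping one of the two endpoints leaves \<open>l - k\<close> nodes, one for each mesh
  cell between \<open>lo i\<close> and \<open>up i\<close>.\<close>

lemma card_nodes: "i < n \<Longrightarrow> h i * card (nodes i - {up i}) = up i - lo i"
proof (rule mesh_bounds[of i])
  fix k l :: int
  assume i: "i < n" and kl: "lo i = h i * of_int k" "up i = h i * of_int l" "l - k > 1"
    "nodes i = (\<lambda>z. h i * of_int z) ` {k..l}"
  have inj: "inj (\<lambda>z::int. h i * of_int z)"
    using h_pos[OF i] by (intro injI) simp
  have "{k..l} - {l} = {k..<l}" by auto
  then have "nodes i - {up i} = (\<lambda>z. h i * of_int z) ` {k..<l}"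
    using image_set_diff[OF inj, of "{k..l}" "{l}"] by (simp add: kl)
  then have "card (nodes i - {up i}) = nat (l - k)"
    using card_image[OF inj_on_subset[OF inj, of "{k..<l}"]] by simp
  then show ?thesis
    using kl by (simp add: algebra_simps)
qed

lemma lo_less_up: "i < n \<Longrightarrow> lo i < up i"
  by (rule mesh_bounds[of i]) (use h_pos in auto)

lemma nodes_lo: "i < n \<Longrightarrow> lo i \<in> nodes i"
  by (rule mesh_bounds[of i]) auto

lemma nodes_succ:
  assumes "i < n" "t \<in> nodes i" "t \<noteq> up i"
  shows "t + h i \<in> nodes i"
proof (rule mesh_bounds[OF assms(1)])
  fix k l :: int
  assume kl: "lo i = h i * of_int k" "up i = h i * of_int l" "nodes i = (\<lambda>z. h i * of_int z) ` {k..l}"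
  then obtain z where z: "z \<in> {k..l}" "t = h i * of_int z" using assms by auto
  with assms kl have "z + 1 \<in> {k..l}" by (auto simp: order_le_less)
  then have "h i * of_int (z + 1) \<in> nodes i" unfolding kl by blast
  then show ?thesis using z by (simp add: algebra_simps)
qed

lemma nodes_pred:
  assumes "i < n" "t \<in> nodes i" "t \<noteq> lo i"
  shows "t - h i \<in> nodes i"
proof (rule mesh_bounds[OF assms(1)])
  fix k l :: int
  assume kl: "lo i = h i * of_int k" "up i = h i * of_int l" "nodes i = (\<lambda>z. h i * of_int z) ` {k..l}"
  then obtain z where z: "z \<in> {k..l}" "t = h i * of_int z" using assms by auto
  with assms kl have "z - 1 \<in> {k..l}" by (auto simp: order_le_less)
  then have "h i * of_int (z - 1) \<in> nodes i" unfolding kl by blast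
  then show ?thesis using z by (simp add: algebra_simps)
qed

text \<open>Points of the grid vanish at indices from \<open>n\<close> on, which is freezing at the
  zero function.\<close>

lemma closed_slab: "C = slab nodes {..<n} (\<lambda>_. 0)"
  by (auto simp: closed_grid_def mesh_grid_def slab_def nodes_def not_less)

lemma finite_closed: "finite C"
  unfolding closed_slab using finite_nodes by (intro finite_slab) auto

lemma open_subset: "Om \<subseteq> C"
  by (auto simp: open_grid_def closed_grid_def less_imp_le)

lemma finite_open: "finite Om"
  using finite_closed open_subset finite_subset by blast

lemma closed_iff: "x \<in> C \<longleftrightarrow> (\<forall>i<n. x i \<in> nodes i) \<and> (\<forall>i\<ge>n. x i = 0)"
  by (auto simp: closed_slab slab_def not_less)

lemma open_iff: "x \<in> Om \<longleftrightarrow> x \<in> C \<and> (\<forall>i<n. x i \<noteq> lo i \<and> x i \<noteq> up i)"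
  by (auto simp: open_grid_def closed_grid_def order_less_le)

lemma base_eq: "i < n \<Longrightarrow> base i = {x \<in> C. x i \<noteq> up i}"
  by (auto simp: top_face_def bdry_grid_def open_iff)

text \<open>The condition \<open>l - k > 1\<close> puts \<open>lo i + h i\<close> strictly between
  the endpoints. Nonemptiness makes the maximum in \<open>sup_norm\<close> meaningful.\<close>

lemma open_nonempty: "Om \<noteq> {}"
proof -
  define x where "x i = (if i < n then lo i + h i else 0)" for i
  have "x i \<in> nodes i \<and> x i \<noteq> lo i \<and> x i \<noteq> up i" if i: "i < n" for i
  proof -
    have "lo i + h i \<noteq> up i"
    proof (rule mesh_bounds[OF i])
      fix k l :: int
      assume kl: "lo i = h i * of_int k" "up i = h i * of_int l" "l - k > 1"
      have "lo i + h i = h i * of_int (k + 1)" using kl by (simp add: algebra_simps)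
      moreover have "h i * of_int (k + 1) \<noteq> h i * of_int l"
        using kl(3) h_pos[OF i] by (simp del: of_int_add)
      ultimately show ?thesis using kl by simp
    qed
    then show ?thesis
      using nodes_succ[OF i nodes_lo[OF i]] lo_less_up[OF i] h_pos[OF i] i by (auto simp: x_def)
  qed
  then have "x \<in> Om"
    by (auto simp: open_iff closed_iff x_def)
  then show ?thesis by blast
qed

text \<open>The interior nodes lie in the half-open box without its upper faces, whose nodes
  correspond one to one to the mesh cells and so account for exactly the volume of the box.\<close>

lemma volume_open: "real (card Om) * H \<le> box_vol n lo up"
proof -
  let ?T = "slab (\<lambda>i. nodes i - {up i}) {..<n} (\<lambda>_. 0)"
  have "Om \<subseteq> ?T"
    by (auto simp: open_iff closed_iff slab_def)
  moreover have "finite ?T"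
    using finite_nodes by (intro finite_slab) auto
  ultimately have "card Om \<le> card ?T"
    by (rule card_mono[rotated])
  also have "\<dots> = (\<Prod>i<n. card (nodes i - {up i}))"
    using finite_nodes by (intro card_slab) auto
  finally have "real (card Om) * H \<le> real (\<Prod>i<n. card (nodes i - {up i})) * H"
    using H_pos by (intro mult_right_mono) (auto simp flip: of_nat_prod)
  also have "\<dots> = (\<Prod>i<n. h i * card (nodes i - {up i}))"
    by (simp add: cell_vol_def prod.distrib)
  also have "\<dots> = box_vol n lo up"
    unfolding box_vol_def by (intro prod.cong) (auto simp: card_nodes)
  finally show ?thesis .
qed

section \<open>Functions vanishing on the boundary and summation by parts\<close>

lemma W012_iff: "W012 n lo up h v \<longleftrightarrow> (\<forall>x\<in>C - Om. v x = 0)"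
  by (simp add: W012_def bdry_grid_def)

lemma sum_closed_open:
  assumes "\<And>x. x \<in> C - Om \<Longrightarrow> v x = 0"
  shows "(\<Sum>x\<in>C. v x) = (\<Sum>x\<in>Om. v x)"
  using assms by (intro sum.mono_neutral_right finite_closed open_subset) auto

lemma sum_base_shift:
  assumes i: "i < n"
  shows "(\<Sum>x\<in>base i. F (unit_shift x i (h i))) = (\<Sum>x\<in>{x \<in> C. x i \<noteq> lo i}. F x)"
proof (rule sum.reindex_bij_witness[where i = "\<lambda>x. unit_shift x i (- h i)" and j = "\<lambda>x. unit_shift x i (h i)"])
  fix x assume x: "x \<in> base i"
  then have "x i \<in> nodes i" "x i \<noteq> up i" using i by (auto simp: base_eq closed_iff)
  then have "x i + h i \<in> nodes i" "x i + h i \<noteq> lo i"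
    using nodes_succ i h_pos[OF i] by (auto simp: nodes_def)
  then show "unit_shift x i (h i) \<in> {x \<in> C. x i \<noteq> lo i}"
    using x i by (auto simp: base_eq closed_iff unit_shift_def)
next
  fix x assume x: "x \<in> {x \<in> C. x i \<noteq> lo i}"
  then have "x i \<in> nodes i" "x i \<noteq> lo i" using i by (auto simp: closed_iff)
  then have "x i - h i \<in> nodes i" "x i - h i \<noteq> up i"
    using nodes_pred i h_pos[OF i] by (auto simp: nodes_def)
  then show "unit_shift x i (- h i) \<in> base i"
    using x i by (auto simp: base_eq closed_iff unit_shift_def)
qed (auto simp: unit_shift_def)

lemma unit_shift_cancel [simp]: "unit_shift (unit_shift x i t) i (- t) = x"
  by (auto simp: unit_shift_def)

text \<open>In each direction the terms carrying \<open>\<phi>\<close> at the far end of an edge are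
  shifted by one node. What is left outside \<open>Om\<close> drops out because
  \<open>\<phi>\<close> vanishes there, and the two one-sided differences of \<open>u\<close>
  combine to the second difference.\<close>

lemma summation_by_parts:
  assumes \<phi>: "W012 n lo up h \<phi>"
  shows "(\<Sum>x\<in>Om. - disc_laplace n h u x * \<phi> x)
    = (\<Sum>i<n. \<Sum>x\<in>base i. fwd_diff h u i x * fwd_diff h \<phi> i x)"
proof -
  have "(\<Sum>x\<in>base i. fwd_diff h u i x * fwd_diff h \<phi> i x)
      = (\<Sum>x\<in>Om. - ((u (unit_shift x i (h i)) - 2 * u x + u (unit_shift x i (- h i))) / (h i)\<^sup>2) * \<phi> x)"
    if i: "i < n" for i
  proof -
    let ?d = "\<lambda>x. u (unit_shift x i (h i)) - u x"
    let ?e = "\<lambda>x. (u x - u (unit_shift x i (- h i))) * \<phi> x"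
    have zero: "x \<in> C \<Longrightarrow> x \<notin> Om \<Longrightarrow> \<phi> x = 0" for x
      using \<phi> by (simp add: W012_iff)
    have fin: "finite (base i)" using finite_closed by simp
    \<comment> \<open>A forward difference at \<open>x\<close> is the backward difference at the
      next node.\<close>
    have "(\<Sum>x\<in>base i. ?d x * \<phi> (unit_shift x i (h i))) = (\<Sum>x\<in>base i. ?e (unit_shift x i (h i)))"
      by simp
    also have "\<dots> = (\<Sum>x\<in>{x \<in> C. x i \<noteq> lo i}. ?e x)"
      by (rule sum_base_shift[OF i])
    also have "\<dots> = (\<Sum>x\<in>Om. ?e x)"
      using i zero finite_closed by (intro sum.mono_neutral_right) (auto simp: open_iff)
    finally have 1: "(\<Sum>x\<in>base i. ?d x * \<phi> (unit_shift x i (h i))) = (\<Sum>x\<in>Om. ?e x)" .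
    have 2: "(\<Sum>x\<in>base i. ?d x * \<phi> x) = (\<Sum>x\<in>Om. ?d x * \<phi> x)"
      using i zero fin by (intro sum.mono_neutral_right) (auto simp: base_eq open_iff)
    have "(\<Sum>x\<in>base i. fwd_diff h u i x * fwd_diff h \<phi> i x)
        = (\<Sum>x\<in>base i. ?d x * \<phi> (unit_shift x i (h i)) - ?d x * \<phi> x) / (h i)\<^sup>2"
      unfolding sum_divide_distrib
      by (intro sum.cong) (auto simp: fwd_diff_def power2_eq_square algebra_simps)
    also have "\<dots> = (\<Sum>x\<in>Om. ?e x - ?d x * \<phi> x) / (h i)\<^sup>2"
      by (simp add: sum_subtractf 1 2)
    also have "\<dots> = (\<Sum>x\<in>Om. - ((u (unit_shift x i (h i)) - 2 * u x + u (unit_shift x i (- h i))) / (h i)\<^sup>2) * \<phi> x)"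
      unfolding sum_divide_distrib
    proof (intro sum.cong refl)
      fix x
      have "?e x - ?d x * \<phi> x = - (u (unit_shift x i (h i)) - 2 * u x + u (unit_shift x i (- h i))) * \<phi> x"
        by (simp add: algebra_simps)
      then show "(?e x - ?d x * \<phi> x) / (h i)\<^sup>2
          = - ((u (unit_shift x i (h i)) - 2 * u x + u (unit_shift x i (- h i))) / (h i)\<^sup>2) * \<phi> x"
        by (simp only: divide_minus_left mult_minus_left times_divide_eq_left)
    qed
    finally show ?thesis .
  qed
  then have "(\<Sum>i<n. \<Sum>x\<in>base i. fwd_diff h u i x * fwd_diff h \<phi> i x)
      = (\<Sum>i<n. \<Sum>x\<in>Om. - ((u (unit_shift x i (h i)) - 2 * u x + u (unit_shift x i (- h i))) / (h i)\<^sup>2) * \<phi> x)"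
    by simp
  also have "\<dots> = (\<Sum>x\<in>Om. - disc_laplace n h u x * \<phi> x)"
    by (subst sum.swap) (simp add: disc_laplace_def sum_distrib_right sum_negf)
  finally show ?thesis by simp
qed

subsection \<open>Discrete Sobolev inequalities\<close>

text \<open>Telescoping from the lower end, where \<open>e\<close> vanishes, by induction on the
  integer position. Enlarging the sum to the whole line makes the bound independent of
  \<open>t\<close>.\<close>

lemma abs_le_sum_increments:
  assumes i: "i < n" and t: "t \<in> nodes i" and e: "e (lo i) = (0::real)"
  shows "\<bar>e t\<bar> \<le> (\<Sum>s\<in>nodes i - {up i}. \<bar>e (s + h i) - e s\<bar>)"
proof (rule mesh_bounds[OF i])
  fix k l :: int
  assume kl: "lo i = h i * of_int k" "up i = h i * of_int l"
    "nodes i = (\<lambda>z. h i * of_int z) ` {k..l}"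
  note hi = h_pos[OF i]
  define B where "B z = (\<lambda>z. h i * of_int z) ` {k..<z}" for z :: int
  have "\<bar>e (h i * of_int z)\<bar> \<le> (\<Sum>s\<in>B z. \<bar>e (s + h i) - e s\<bar>)" if "k \<le> z" for z
    using that
  proof (induction z rule: int_ge_induct)
    case base
    then show ?case using e by (simp add: kl sum_nonneg)
  next
    case (step z)
    let ?s = "h i * of_int z"
    have "{k..<z + 1} = insert z {k..<z}" using step by auto
    then have "B (z + 1) = insert ?s (B z)" by (simp add: B_def)
    moreover have "?s \<notin> B z" using hi by (auto simp: B_def)
    moreover have "finite (B z)" by (simp add: B_def)
    moreover have "\<bar>e (?s + h i)\<bar> \<le> \<bar>e ?s\<bar> + \<bar>e (?s + h i) - e ?s\<bar>" by linarith
    moreover have "h i * of_int (z + 1) = ?s + h i" by (simp add: algebra_simps)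
    ultimately show ?case
      using step by simp
  qed
  moreover obtain z where z: "k \<le> z" "z \<le> l" "t = h i * of_int z"
    using t kl by auto
  ultimately have "\<bar>e t\<bar> \<le> (\<Sum>s\<in>B z. \<bar>e (s + h i) - e s\<bar>)" by blast
  also have "\<dots> \<le> (\<Sum>s\<in>nodes i - {up i}. \<bar>e (s + h i) - e s\<bar>)"
    using finite_nodes[OF i] z hi by (intro sum_mono2) (auto simp: B_def kl)
  finally show ?thesis .
qed

text \<open>Along every grid line \<open>\<bar>g\<bar>\<close> is bounded by the total variation, which does not depend on
  the position on the line; the product of these \<open>n\<close> bounds is summed by Loomis--Whitney.\<close>

lemma Gagliardo_Nirenberg:
  assumes n: "n \<ge> 2" and g: "W012 n lo up h g"
  shows "(\<Sum>x\<in>C. \<bar>g x\<bar> powr (n / (n - 1)) * H) powr ((real n - 1) / n)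
    \<le> (\<Sum>j<n. \<Sum>x\<in>base j. \<bar>fwd_diff h g j x\<bar> * H) / n"
proof -
  \<comment> \<open>The value 0 on the top face lets sums run over all of \<open>nodes j\<close>, as
    required for slabs, while counting only genuine edges.\<close>
  define G where "G j y = (if y j = up j then 0 else \<bar>g (unit_shift y j (h j)) - g y\<bar>)" for j y
  define F where "F j y = (\<Sum>t\<in>nodes j. G j (y(j := t)))" for j y
  define w where "w = 1 / (real n - 1)"
  define E where "E j = (\<Sum>x\<in>base j. \<bar>fwd_diff h g j x\<bar> * H)" for j
  have w: "w > 0" using n by (simp add: w_def)
  have E0: "E j \<ge> 0" for j
    using H_pos by (simp add: E_def sum_nonneg)
  have point: "\<bar>g x\<bar> \<le> F j x" if x: "x \<in> C" and j: "j < n" for x j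
  proof -
    have "x(j := lo j) \<in> C - Om"
      using x nodes_lo[OF j] j by (auto simp: closed_iff open_iff)
    then have "g (x(j := lo j)) = 0"
      using g by (simp add: W012_iff)
    then have "\<bar>g (x(j := x j))\<bar> \<le> (\<Sum>t\<in>nodes j - {up j}. \<bar>g (x(j := t + h j)) - g (x(j := t))\<bar>)"
      using x j by (intro abs_le_sum_increments[where e = "\<lambda>t. g (x(j := t))"]) (auto simp: closed_iff)
    also have "\<dots> = F j x"
      unfolding F_def using finite_nodes[OF j]
      by (intro sum.mono_neutral_cong_left) (auto simp: G_def unit_shift_def)
    finally show ?thesis by simp
  qed
  have sumF: "sum (F j) (slab nodes ({..<n} - {j}) (\<lambda>_. 0)) = E j * (h j / H)" if j: "j < n" for j
  proof -
    have "{..<n} = insert j ({..<n} - {j})" using j by auto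
    then have "sum (F j) (slab nodes ({..<n} - {j}) (\<lambda>_. 0)) = sum (G j) C"
      unfolding closed_slab F_def
      using sum_slab_insert'[of "{..<n} - {j}" j nodes "G j" "\<lambda>_. 0"] finite_nodes j
      by (simp add: insert_absorb)
    also have "\<dots> = (\<Sum>x\<in>base j. \<bar>g (unit_shift x j (h j)) - g x\<bar>)"
      using finite_closed j by (intro sum.mono_neutral_cong_right) (auto simp: G_def base_eq)
    also have "\<dots> = (\<Sum>x\<in>base j. \<bar>fwd_diff h g j x\<bar> * H * (h j / H))"
      using H_pos h_pos[OF j] by (intro sum.cong) (auto simp: fwd_diff_def)
    also have "\<dots> = E j * (h j / H)"
      by (simp only: E_def sum_distrib_right)
    finally show ?thesis .
  qed
  have "(\<Sum>x\<in>C. \<bar>g x\<bar> powr (n / (n - 1))) \<le> (\<Sum>x\<in>C. \<Prod>j<n. F j x powr w)"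
  proof (intro sum_mono)
    fix x assume x: "x \<in> C"
    have "\<bar>g x\<bar> powr (n / (n - 1)) = (\<Prod>j<n. \<bar>g x\<bar> powr w)"
      using n by (cases "g x = 0") (simp_all add: w_def of_nat_diff powr_power)
    also have "\<dots> \<le> (\<Prod>j<n. F j x powr w)"
      using point[OF x] w by (intro prod_mono conjI powr_mono2) auto
    finally show "\<bar>g x\<bar> powr (n / (n - 1)) \<le> (\<Prod>j<n. F j x powr w)" .
  qed
  also have "\<dots> \<le> (\<Prod>j<n. sum (F j) (slab nodes ({..<n} - {j}) (\<lambda>_. 0)) powr w)"
    using Loomis_Whitney[of "{..<n}" "{..<n}" nodes F "\<lambda>_. 0"] finite_nodes n
    by (simp add: closed_slab w_def F_def G_def sum_nonneg)
  also have "\<dots> = (\<Prod>j<n. E j * (h j / H)) powr w"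
    by (simp add: sumF prod_powr_distrib)
  also have "(\<Prod>j<n. E j * (h j / H)) = (\<Prod>j<n. E j) * ((\<Prod>j<n. h j) / H ^ n)"
    by (simp add: prod.distrib prod_dividef)
  also have "(\<Prod>j<n. h j) / H ^ n = H powr (1 - real n)"
    using H_pos by (simp add: powr_diff powr_realpow flip: cell_vol_def)
  also have "((\<Prod>j<n. E j) * H powr (1 - real n)) powr w = (\<Prod>j<n. E j) powr w * (1 / H)"
  proof -
    \<comment> \<open>The powers of \<open>H\<close> collapse to \<open>1 / H\<close>, which
      supplies the cell volume missing in the sum on the left.\<close>
    have "(1 - real n) * w = -1" using n by (simp add: w_def field_simps)
    then show ?thesis using H_pos by (simp add: powr_mult powr_powr powr_minus_divide)
  qed
  finally have "(\<Sum>x\<in>C. \<bar>g x\<bar> powr (n / (n - 1))) * H \<le> (\<Prod>j<n. E j) powr w"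
    using H_pos by (simp add: field_simps)
  then have "(\<Sum>x\<in>C. \<bar>g x\<bar> powr (n / (n - 1)) * H) \<le> (\<Prod>j<n. E j) powr w"
    by (simp only: sum_distrib_right)
  then have "(\<Sum>x\<in>C. \<bar>g x\<bar> powr (n / (n - 1)) * H) powr ((real n - 1) / n)
      \<le> ((\<Prod>j<n. E j) powr w) powr ((real n - 1) / n)"
    using H_pos n by (intro powr_mono2) (auto simp: sum_nonneg)
  also have "\<dots> = (\<Prod>j<n. E j powr (1 / n))"
    using n by (simp add: powr_powr w_def prod_powr_distrib)
  \<comment> \<open>The geometric mean of the directional sums is replaced by their arithmetic
    mean.\<close>
  also have "\<dots> \<le> (\<Sum>j<n. 1 / n * E j)"
    using E0 n by (intro weighted_am_gm) auto
  finally show ?thesis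
    by (simp add: E_def flip: sum_divide_distrib)
qed

lemma D_norm_nonneg: "D_norm n lo up h f \<ge> 0"
  unfolding D_norm_def using H_pos by (simp add: sum_nonneg)

lemma sum_sqrt_le_D_norm:
  "(\<Sum>j<n. sqrt (\<Sum>x\<in>base j. \<bar>fwd_diff h f j x\<bar>\<^sup>2 * H)) \<le> sqrt n * D_norm n lo up h f"
proof -
  define d where "d j = (\<Sum>x\<in>base j. \<bar>fwd_diff h f j x\<bar>\<^sup>2 * H)" for j
  have d: "d j \<ge> 0" for j
    using H_pos by (simp add: d_def sum_nonneg)
  have "(\<Sum>j<n. 1 * sqrt (d j)) \<le> sqrt (\<Sum>j<n. 1\<^sup>2) * sqrt (\<Sum>j<n. (sqrt (d j))\<^sup>2)"
    by (rule Cauchy_Schwarz_sqrt)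
  then show ?thesis
    unfolding D_norm_def d_def[symmetric] using d by simp
qed

text \<open>\<open>Gagliardo_Nirenberg\<close> is applied to \<open>f\<close> raised to the power
  \<open>\<gamma>\<close>. \<open>abs_powr_diff_le\<close> splits its differences into differences
  of \<open>f\<close> times a power of \<open>f\<close>, and Cauchy-Schwarz separates the
  two.\<close>

lemma Sobolev_power:
  assumes n: "n \<ge> 2" and f: "W012 n lo up h f" and f0: "\<And>x. f x \<ge> 0" and \<gamma>: "\<gamma> > 1"
  shows "(\<Sum>x\<in>C. f x powr (\<gamma> * (n / (n - 1))) * H) powr ((real n - 1) / n)
    \<le> \<gamma> * sqrt 2 / sqrt n * D_norm n lo up h f * sqrt (\<Sum>x\<in>C. f x powr (2 * \<gamma> - 2) * H)"
proof -
  define X where "X = (\<Sum>x\<in>C. f x powr (2 * \<gamma> - 2) * H)"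
  have step: "(\<Sum>x\<in>base j. \<bar>fwd_diff h (\<lambda>x. f x powr \<gamma>) j x\<bar> * H)
      \<le> \<gamma> * sqrt 2 * sqrt X * sqrt (\<Sum>x\<in>base j. \<bar>fwd_diff h f j x\<bar>\<^sup>2 * H)" if j: "j < n" for j
  proof -
    define m where "m x = max (f (unit_shift x j (h j))) (f x)" for x
    \<comment> \<open>The maximum over an edge is bounded by the sum over its two ends. Within one
      direction a node is at most once a lower and once an upper end, whence the factor 2.\<close>
    have mX: "(\<Sum>x\<in>base j. (m x powr (\<gamma> - 1) * sqrt H)\<^sup>2) \<le> 2 * X"
    proof -
      have sq: "(y powr (\<gamma> - 1))\<^sup>2 = y powr (2 * \<gamma> - 2)" for y :: real
        by (simp add: power2_eq_square flip: powr_add)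
      have "(\<Sum>x\<in>base j. (m x powr (\<gamma> - 1) * sqrt H)\<^sup>2)
          \<le> (\<Sum>x\<in>base j. f (unit_shift x j (h j)) powr (2 * \<gamma> - 2) * H + f x powr (2 * \<gamma> - 2) * H)"
        using H_pos by (intro sum_mono) (auto simp: power_mult_distrib sq m_def max_def)
      also have "\<dots> = (\<Sum>x\<in>{x \<in> C. x j \<noteq> lo j}. f x powr (2 * \<gamma> - 2) * H)
          + (\<Sum>x\<in>base j. f x powr (2 * \<gamma> - 2) * H)"
        by (simp add: sum.distrib sum_base_shift[OF j, of "\<lambda>x. f x powr (2 * \<gamma> - 2) * H"])
      also have "\<dots> \<le> X + X"
        unfolding X_def using finite_closed H_pos by (intro add_mono sum_mono2) auto
      finally show ?thesis by simp
    qed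
    have "(\<Sum>x\<in>base j. \<bar>fwd_diff h (\<lambda>x. f x powr \<gamma>) j x\<bar> * H)
        \<le> (\<Sum>x\<in>base j. \<gamma> * ((\<bar>fwd_diff h f j x\<bar> * sqrt H) * (m x powr (\<gamma> - 1) * sqrt H)))"
    proof (intro sum_mono)
      fix x
      have "\<bar>f (unit_shift x j (h j)) powr \<gamma> - f x powr \<gamma>\<bar> / h j
          \<le> \<gamma> * m x powr (\<gamma> - 1) * \<bar>f (unit_shift x j (h j)) - f x\<bar> / h j"
        unfolding m_def using h_pos[OF j] f0 \<gamma> by (intro divide_right_mono abs_powr_diff_le) auto
      then have "\<bar>fwd_diff h (\<lambda>x. f x powr \<gamma>) j x\<bar> \<le> \<gamma> * m x powr (\<gamma> - 1) * \<bar>fwd_diff h f j x\<bar>"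
        using h_pos[OF j] by (simp add: fwd_diff_def)
      then have "\<bar>fwd_diff h (\<lambda>x. f x powr \<gamma>) j x\<bar> * H \<le> \<gamma> * m x powr (\<gamma> - 1) * \<bar>fwd_diff h f j x\<bar> * (sqrt H * sqrt H)"
        using H_pos by simp
      then show "\<bar>fwd_diff h (\<lambda>x. f x powr \<gamma>) j x\<bar> * H
          \<le> \<gamma> * ((\<bar>fwd_diff h f j x\<bar> * sqrt H) * (m x powr (\<gamma> - 1) * sqrt H))"
        by (simp only: mult_ac)
    qed
    also have "\<dots> \<le> \<gamma> * (sqrt (\<Sum>x\<in>base j. (\<bar>fwd_diff h f j x\<bar> * sqrt H)\<^sup>2)
        * sqrt (\<Sum>x\<in>base j. (m x powr (\<gamma> - 1) * sqrt H)\<^sup>2))"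
      unfolding sum_distrib_left[symmetric] using \<gamma> by (intro mult_left_mono Cauchy_Schwarz_sqrt) auto
    also have "(\<Sum>x\<in>base j. (\<bar>fwd_diff h f j x\<bar> * sqrt H)\<^sup>2) = (\<Sum>x\<in>base j. \<bar>fwd_diff h f j x\<bar>\<^sup>2 * H)"
      using H_pos by (simp add: power_mult_distrib)
    also have "\<gamma> * (sqrt (\<Sum>x\<in>base j. \<bar>fwd_diff h f j x\<bar>\<^sup>2 * H) * sqrt (\<Sum>x\<in>base j. (m x powr (\<gamma> - 1) * sqrt H)\<^sup>2))
        \<le> \<gamma> * (sqrt (\<Sum>x\<in>base j. \<bar>fwd_diff h f j x\<bar>\<^sup>2 * H) * sqrt (2 * X))"
      using mX \<gamma> H_pos by (intro mult_left_mono real_sqrt_le_mono) (auto intro!: sum_nonneg)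
    finally show ?thesis
      by (simp only: real_sqrt_mult mult_ac)
  qed
  have g: "W012 n lo up h (\<lambda>x. f x powr \<gamma>)"
    using f by (simp add: W012_def)
  have "(\<Sum>x\<in>C. f x powr (\<gamma> * (n / (n - 1))) * H) powr ((real n - 1) / n)
      \<le> (\<Sum>j<n. \<Sum>x\<in>base j. \<bar>fwd_diff h (\<lambda>x. f x powr \<gamma>) j x\<bar> * H) / n"
    using Gagliardo_Nirenberg[OF n g] by (simp add: powr_powr)
  also have "\<dots> \<le> (\<Sum>j<n. \<gamma> * sqrt 2 * sqrt X * sqrt (\<Sum>x\<in>base j. \<bar>fwd_diff h f j x\<bar>\<^sup>2 * H)) / n"
    using step by (intro divide_right_mono sum_mono) auto
  also have "\<dots> = \<gamma> * sqrt 2 * sqrt X * (\<Sum>j<n. sqrt (\<Sum>x\<in>base j. \<bar>fwd_diff h f j x\<bar>\<^sup>2 * H)) / n"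
    by (simp add: sum_distrib_left)
  also have "\<dots> \<le> \<gamma> * sqrt 2 * sqrt X * (sqrt n * D_norm n lo up h f) / n"
    using \<gamma> H_pos sum_sqrt_le_D_norm[of f]
    by (intro divide_right_mono mult_left_mono) (auto simp: X_def sum_nonneg)
  also have "\<dots> = \<gamma> * sqrt 2 / sqrt n * D_norm n lo up h f * sqrt X"
    using n by (simp add: field_simps)
  finally show ?thesis by (simp add: X_def)
qed

text \<open>The choice of \<open>\<gamma>\<close> makes both exponents in
  \<open>Sobolev_power\<close> equal to \<open>\<rho>\<close>, so the same sum \<open>X\<close>
  stands on both sides. Dividing by \<open>sqrt X\<close> leaves the power
  \<open>1 / \<rho>\<close>.\<close>

lemma Sobolev_high_dim:
  assumes n: "n \<ge> 3" and f: "W012 n lo up h f" and f0: "\<And>x. f x \<ge> 0"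
    and \<rho>: "\<rho> = 2 * real n / (real n - 2)"
  shows "(\<Sum>x\<in>C. f x powr \<rho> * H) powr (1 / \<rho>) \<le> C_S n * D_norm n lo up h f"
proof -
  define X where "X = (\<Sum>x\<in>C. f x powr \<rho> * H)"
  define \<gamma> where "\<gamma> = 2 * (real n - 1) / (real n - 2)"
  have \<gamma>: "\<gamma> > 1" and \<gamma>2: "2 * \<gamma> - 2 = \<rho>"
    using n by (simp_all add: \<gamma>_def \<rho> field_simps)
  have \<gamma>1: "\<gamma> * (n / (n - 1)) = \<rho>"
    using n by (simp add: \<gamma>_def \<rho> divide_simps of_nat_diff)
  have X0: "X \<ge> 0"
    using H_pos by (simp add: X_def sum_nonneg)
  \<comment> \<open>\<open>C_S n\<close> equals \<open>2 * \<gamma> / sqrt n\<close>, so rounding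
    \<open>sqrt 2\<close> up to 2 suffices.\<close>
  have c: "\<gamma> * sqrt 2 / sqrt n \<le> C_S n"
  proof -
    have "sqrt 2 \<le> (2::real)" using real_sqrt_le_mono[of 2 4] by simp
    then have "\<gamma> * sqrt 2 \<le> \<gamma> * 2" using \<gamma> by simp
    then have "\<gamma> * sqrt 2 / sqrt n \<le> \<gamma> * 2 / sqrt n" by (intro divide_right_mono) auto
    also have "\<dots> = C_S n" using n by (simp add: C_S_def \<gamma>_def)
    finally show ?thesis .
  qed
  have main: "X powr ((real n - 1) / n) \<le> C_S n * D_norm n lo up h f * sqrt X"
  proof -
    have "X powr ((real n - 1) / n) \<le> \<gamma> * sqrt 2 / sqrt n * D_norm n lo up h f * sqrt X"
      using Sobolev_power[OF _ f f0 \<gamma>] n unfolding \<gamma>1 \<gamma>2 by (simp add: X_def)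
    also have "\<dots> \<le> C_S n * D_norm n lo up h f * sqrt X"
      using c D_norm_nonneg X0 by (intro mult_right_mono) auto
    finally show ?thesis .
  qed
  have "X powr (1 / \<rho>) \<le> C_S n * D_norm n lo up h f"
  proof (cases "X = 0")
    case True
    have "C_S n \<ge> 0" using n by (simp add: C_S_def)
    then show ?thesis using True D_norm_nonneg by simp
  next
    case False
    with X0 have X: "X > 0" by simp
    have "(real n - 1) / n = 1 / \<rho> + 1 / 2"
      using n by (simp add: \<rho> field_simps of_nat_diff)
    then have "X powr (1 / \<rho>) * sqrt X \<le> C_S n * D_norm n lo up h f * sqrt X"
      using main X by (simp add: powr_add powr_half_sqrt)
    then show ?thesis using X by simp
  qed
  then show ?thesis by (simp add: X_def)
qed

text \<open>Log-convexity of moments in the exponent: Hoelder's inequality, with the weight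
  \<open>c\<close> split as \<open>c powr \<alpha> * c powr \<beta>\<close>.\<close>

lemma sum_powr_interpolate:
  fixes f :: "'b \<Rightarrow> real" and c :: real
  assumes "finite S" "\<And>x. x \<in> S \<Longrightarrow> f x \<ge> 0" "0 \<le> c" "0 \<le> \<alpha>" "0 \<le> \<beta>" "\<alpha> + \<beta> = 1"
  shows "(\<Sum>x\<in>S. f x powr (r * \<alpha> + s * \<beta>) * c)
    \<le> (\<Sum>x\<in>S. f x powr r * c) powr \<alpha> * (\<Sum>x\<in>S. f x powr s * c) powr \<beta>"
proof -
  have "f x powr (r * \<alpha> + s * \<beta>) * c = (f x powr r * c) powr \<alpha> * (f x powr s * c) powr \<beta>" for x
  proof (cases "c = 0")
    case False
    have "c powr \<alpha> * c powr \<beta> = c powr (\<alpha> + \<beta>)"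
      by (simp only: powr_add)
    then have "c = c powr \<alpha> * c powr \<beta>"
      using assms False by simp
    then show ?thesis
      by (simp add: powr_mult powr_powr powr_add mult_ac)
  qed simp
  then show ?thesis
    using Hoelder_sum[of S \<alpha> \<beta> "\<lambda>x. f x powr r * c" "\<lambda>x. f x powr s * c"] assms by simp
qed

text \<open>Testing with the indicator of one interior node makes the left side positive, while
  \<open>D_norm\<close> is never negative.\<close>

lemma Poincare_const_pos:
  assumes "is_poincare_const n lo up h CP"
  shows "CP > 0"
proof -
  obtain z where z: "z \<in> Om" using open_nonempty by blast
  define v :: "pt \<Rightarrow> real" where "v x = (if x = z then 1 else 0)" for x
  have "W012 n lo up h v"
    using z by (auto simp: W012_iff v_def)
  then have le: "Lr_norm n h 2 C v \<le> CP * D_norm n lo up h v"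
    using assms by (simp add: is_poincare_const_def)
  have "(\<Sum>x\<in>C. \<bar>v x\<bar> powr 2 * H) \<ge> \<bar>v z\<bar> powr 2 * H"
    using z open_subset finite_closed H_pos by (intro member_le_sum) auto
  then have "Lr_norm n h 2 C v > 0"
    using H_pos by (simp add: Lr_norm_def v_def)
  with le have "CP * D_norm n lo up h v > 0" by linarith
  then show ?thesis
    using D_norm_nonneg[of v] by (simp add: zero_less_mult_iff)
qed

text \<open>\<open>Sobolev_power\<close> with \<open>\<gamma> = \<rho>/2 + 1\<close> bounds the norm with exponent \<open>\<rho> + 2\<close> by the one with exponent \<open>\<rho>\<close>,
  which in turn is interpolated between \<open>2\<close> and \<open>\<rho> + 2\<close>.\<close>

lemma Sobolev_dim_two:
  assumes n: "n = 2" and f: "W012 n lo up h f" and f0: "\<And>x. f x \<ge> 0" and \<rho>: "\<rho> > 2"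
    and CP: "is_poincare_const n lo up h CP"
  shows "(\<Sum>x\<in>C. f x powr \<rho> * H) powr (1 / \<rho>) \<le> (\<rho> / 2 + 1) * (1 + CP) * D_norm n lo up h f"
proof -
  define X where "X r = (\<Sum>x\<in>C. f x powr r * H)" for r
  define \<gamma> where "\<gamma> = \<rho> / 2 + 1"
  define D where "D = D_norm n lo up h f"
  have D0: "D \<ge> 0" by (simp add: D_def D_norm_nonneg)
  have X0: "X r \<ge> 0" for r
    using H_pos by (simp add: X_def sum_nonneg)
  have CP0: "CP > 0" using Poincare_const_pos[OF CP] .
  have \<gamma>: "\<gamma> > 1" using \<rho> by (simp add: \<gamma>_def)
  have X2: "X 2 \<le> ((1 + CP) * D)\<^sup>2"
  proof -
    have "sqrt (X 2) = Lr_norm n h 2 C f"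
      using f0 H_pos by (simp add: Lr_norm_def X_def powr_half_sqrt sum_nonneg)
    also have "\<dots> \<le> CP * D"
      using CP f by (simp add: is_poincare_const_def D_def)
    also have "\<dots> \<le> (1 + CP) * D" using D0 by (simp add: algebra_simps)
    finally have "sqrt (X 2) \<le> (1 + CP) * D" .
    then show ?thesis
      using X0[of 2] by (metis power_mono real_sqrt_ge_zero real_sqrt_pow2)
  qed
  have up: "X (\<rho> + 2) \<le> (\<gamma> * D)\<^sup>2 * X \<rho>"
  proof -
    \<comment> \<open>For \<open>n = 2\<close> the two exponents differ by exactly 2, and
      \<open>sqrt 2 / sqrt n\<close> cancels.\<close>
    have e: "\<gamma> * (real n / real (n - 1)) = \<rho> + 2" "2 * \<gamma> - 2 = \<rho>" "(real n - 1) / n = 1 / 2"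
      using n by (simp_all add: \<gamma>_def)
    have "X (\<rho> + 2) powr (1 / 2) \<le> \<gamma> * sqrt 2 / sqrt n * D * sqrt (X \<rho>)"
      using Sobolev_power[OF _ f f0 \<gamma>] n unfolding e X_def D_def by simp
    then have "sqrt (X (\<rho> + 2)) \<le> \<gamma> * D * sqrt (X \<rho>)"
      using X0 n by (simp add: powr_half_sqrt)
    then have "(sqrt (X (\<rho> + 2)))\<^sup>2 \<le> (\<gamma> * D * sqrt (X \<rho>))\<^sup>2"
      using X0 by (intro power_mono) auto
    then show ?thesis
      using X0 by (simp add: power_mult_distrib)
  qed
  have interp: "X \<rho> \<le> X 2 powr (2 / \<rho>) * X (\<rho> + 2) powr (1 - 2 / \<rho>)"
  proof -
    have e: "2 * (2 / \<rho>) + (\<rho> + 2) * (1 - 2 / \<rho>) = \<rho>"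
      using \<rho> by (simp add: field_simps)
    show ?thesis
      using sum_powr_interpolate[OF finite_closed, of f H "2 / \<rho>" "1 - 2 / \<rho>" 2 "\<rho> + 2"] f0 \<rho> H_pos
      unfolding e by (simp add: X_def)
  qed
  have "X \<rho> powr (1 / \<rho>) \<le> \<gamma> * (1 + CP) * D"
  proof (cases "X \<rho> = 0")
    case True
    then show ?thesis using \<gamma> CP0 D0 by simp
  next
    case False
    with X0 have X\<rho>: "X \<rho> > 0" by (simp add: order_less_le)
    define \<theta> where "\<theta> = 2 / \<rho>"
    have \<theta>: "0 < \<theta>" "\<theta> < 1" using \<rho> by (auto simp: \<theta>_def)
    have "X \<rho> \<le> X 2 powr \<theta> * ((\<gamma> * D)\<^sup>2 * X \<rho>) powr (1 - \<theta>)"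
      using interp up X0 \<theta>
      by (smt (verit, best) \<theta>_def mult_left_mono powr_ge_zero powr_mono2)
    also have "\<dots> = (X 2 powr \<theta> * ((\<gamma> * D)\<^sup>2) powr (1 - \<theta>)) * X \<rho> powr (1 - \<theta>)"
      by (simp add: powr_mult)
    \<comment> \<open>Splitting off \<open>X \<rho> powr (1 - \<theta>)\<close> absorbs the norm
      with exponent \<open>\<rho>\<close> that came in through \<open>up\<close>.\<close>
    finally have "X \<rho> powr \<theta> * X \<rho> powr (1 - \<theta>) \<le> (X 2 powr \<theta> * ((\<gamma> * D)\<^sup>2) powr (1 - \<theta>)) * X \<rho> powr (1 - \<theta>)"
      using X\<rho> by (simp flip: powr_add)
    then have "X \<rho> powr \<theta> \<le> X 2 powr \<theta> * ((\<gamma> * D)\<^sup>2) powr (1 - \<theta>)"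
      using X\<rho> by simp
    \<comment> \<open>Both bases are raised to a common one, so that the exponents
      \<open>\<theta>\<close> and \<open>1 - \<theta>\<close> add up to 1; hence the combined
      constant \<open>\<gamma> * (1 + CP)\<close>.\<close>
    also have "\<dots> \<le> ((\<gamma> * (1 + CP) * D)\<^sup>2) powr \<theta> * ((\<gamma> * (1 + CP) * D)\<^sup>2) powr (1 - \<theta>)"
    proof (intro mult_mono powr_mono2)
      have "(1 + CP) * D \<le> \<gamma> * ((1 + CP) * D)"
        using \<gamma> CP0 D0 mult_right_mono[of 1 \<gamma> "(1 + CP) * D"] by simp
      then have "((1 + CP) * D)\<^sup>2 \<le> (\<gamma> * (1 + CP) * D)\<^sup>2"
        using CP0 D0 by (intro power_mono) (auto simp: mult_ac)
      then show "X 2 \<le> (\<gamma> * (1 + CP) * D)\<^sup>2" using X2 by linarith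
      have "\<gamma> * D \<le> \<gamma> * D * (1 + CP)"
        using \<gamma> CP0 D0 mult_left_mono[of 1 "1 + CP" "\<gamma> * D"] by simp
      then show "(\<gamma> * D)\<^sup>2 \<le> (\<gamma> * (1 + CP) * D)\<^sup>2"
        using \<gamma> D0 by (intro power_mono) (auto simp: mult_ac)
    qed (use \<theta> X0 in auto)
    also have "\<dots> = ((\<gamma> * (1 + CP) * D)\<^sup>2) powr (\<theta> + (1 - \<theta>))"
      by (simp only: powr_add)
    also have "\<dots> = (\<gamma> * (1 + CP) * D)\<^sup>2"
      by simp
    finally have "sqrt (X \<rho> powr \<theta>) \<le> \<gamma> * (1 + CP) * D"
      using \<gamma> CP0 D0 by (intro real_le_lsqrt) auto
    moreover have "sqrt (X \<rho> powr \<theta>) = X \<rho> powr (1 / \<rho>)"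
      by (simp add: powr_powr \<theta>_def flip: powr_half_sqrt)
    ultimately show ?thesis by simp
  qed
  then show ?thesis by (simp add: X_def \<gamma>_def D_def)
qed

subsection \<open>Moser iteration\<close>

text \<open>The chord inequality, applied on each edge, bounds the energy of the power by the
  pairing of the differences of \<open>u\<close> and \<open>\<phi>\<close>. Summation by parts turns
  this pairing into the equation tested with \<open>\<phi>\<close>.\<close>

lemma energy_estimate:
  assumes u: "W012 n lo up h u"
    and eq: "\<And>x. x \<in> Om \<Longrightarrow> - disc_laplace n h u x = a x * u x + b x"
    and p: "p \<ge> 1"
  shows "(D_norm n lo up h (\<lambda>x. \<bar>u x\<bar> powr p))\<^sup>2
    \<le> p * (\<Sum>x\<in>Om. (\<bar>a x\<bar> * \<bar>u x\<bar> + \<bar>b x\<bar>) * \<bar>u x\<bar> powr (2 * p - 1) * H)"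
proof -
  define f where "f x = \<bar>u x\<bar> powr p" for x
  define \<phi> where "\<phi> x = sgn (u x) * \<bar>u x\<bar> powr (2 * p - 1)" for x
  have \<phi>: "W012 n lo up h \<phi>"
    using u by (simp add: W012_def \<phi>_def)
  have abs\<phi>: "\<bar>\<phi> x\<bar> = \<bar>u x\<bar> powr (2 * p - 1)" for x
    by (cases "u x = 0") (simp_all add: \<phi>_def abs_mult)
  have "(D_norm n lo up h f)\<^sup>2 = (\<Sum>i<n. \<Sum>x\<in>base i. \<bar>fwd_diff h f i x\<bar>\<^sup>2 * H)"
    unfolding D_norm_def using H_pos by (intro real_sqrt_pow2 sum_nonneg) auto
  also have "\<dots> \<le> (\<Sum>i<n. \<Sum>x\<in>base i. p * (fwd_diff h u i x * fwd_diff h \<phi> i x) * H)"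
  proof (intro sum_mono mult_right_mono)
    fix i x
    let ?y = "unit_shift x i (h i)"
    have "(f ?y - f x)\<^sup>2 / (h i)\<^sup>2 \<le> p * ((u ?y - u x) * (\<phi> ?y - \<phi> x)) / (h i)\<^sup>2"
      unfolding f_def \<phi>_def using signed_powr_chord_ineq[OF p] by (intro divide_right_mono) auto
    then show "\<bar>fwd_diff h f i x\<bar>\<^sup>2 \<le> p * (fwd_diff h u i x * fwd_diff h \<phi> i x)"
      by (simp add: fwd_diff_def power_divide power2_eq_square)
  qed (use H_pos in auto)
  also have "\<dots> = p * ((\<Sum>i<n. \<Sum>x\<in>base i. fwd_diff h u i x * fwd_diff h \<phi> i x) * H)"
    by (simp add: sum_distrib_left sum_distrib_right mult_ac)
  also have "\<dots> = p * (\<Sum>x\<in>Om. (a x * u x + b x) * \<phi> x * H)"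
    by (simp add: eq sum_distrib_right flip: summation_by_parts[OF \<phi>])
  also have "\<dots> \<le> p * (\<Sum>x\<in>Om. (\<bar>a x\<bar> * \<bar>u x\<bar> + \<bar>b x\<bar>) * \<bar>u x\<bar> powr (2 * p - 1) * H)"
  proof (intro mult_left_mono sum_mono mult_right_mono)
    fix x
    have "(a x * u x + b x) * \<phi> x \<le> \<bar>a x * u x + b x\<bar> * \<bar>\<phi> x\<bar>"
      by (metis abs_ge_self abs_mult)
    also have "\<dots> \<le> (\<bar>a x\<bar> * \<bar>u x\<bar> + \<bar>b x\<bar>) * \<bar>\<phi> x\<bar>"
      by (intro mult_right_mono) (simp_all add: abs_mult[symmetric])
    finally show "(a x * u x + b x) * \<phi> x \<le> (\<bar>a x\<bar> * \<bar>u x\<bar> + \<bar>b x\<bar>) * \<bar>u x\<bar> powr (2 * p - 1)"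
      by (simp only: abs\<phi>)
  qed (use H_pos p in auto)
  finally show ?thesis by (simp add: f_def[abs_def])
qed

lemma Lr_norm_powr:
  assumes "r > 0"
  shows "Lr_norm n h r S v powr r = (\<Sum>x\<in>S. \<bar>v x\<bar> powr r * H)"
  using assms H_pos by (simp add: Lr_norm_def powr_powr sum_nonneg)

lemma Lr_norm_nonneg [simp]: "Lr_norm n h r S v \<ge> 0"
  by (simp add: Lr_norm_def)

text \<open>The energy estimate is fed into \<open>Sob\<close> for the power \<open>p\<close> of
  \<open>\<bar>u\<bar>\<close>, and Hoelder with exponents \<open>q\<close> and \<open>q'\<close>
  separates the coefficient from \<open>u\<close>. The gain is the passage from exponent
  \<open>2 * q' * p\<close> to \<open>\<rho> * p\<close>.\<close>

lemma Moser_step: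
  assumes u: "W012 n lo up h u"
    and eq: "\<And>x. x \<in> Om \<Longrightarrow> - disc_laplace n h u x = a x * u x + b x"
    and Sob: "\<And>f. W012 n lo up h f \<Longrightarrow> (\<And>x. f x \<ge> 0) \<Longrightarrow>
      (\<Sum>x\<in>C. f x powr \<rho> * H) powr (1 / \<rho>) \<le> Cs * D_norm n lo up h f"
    and Cs: "Cs \<ge> 0" and \<rho>: "\<rho> > 0" and q: "q > 1" and q': "q' = q / (q - 1)" and p: "p \<ge> 1"
    and A: "A = Lr_norm n h q Om (\<lambda>x. \<bar>a x\<bar> + 1)"
    and k: "k \<ge> 0" "\<And>x. x \<in> Om \<Longrightarrow> \<bar>b x\<bar> \<le> k"
    and N: "Lr_norm n h (2 * q' * p) Om u \<le> N" "k * (1 + box_vol n lo up) \<le> N"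
  shows "Lr_norm n h (\<rho> * p) Om u \<le> (Cs * sqrt 2 * A powr (1 / 2) * p) powr (1 / p) * N"
proof -
  define r where "r = 2 * q' * p"
  \<comment> \<open>Replacing \<open>\<bar>u x\<bar>\<close> by this maximum absorbs the source term
    into the coefficient, which becomes \<open>\<bar>a x\<bar> + 1\<close>.\<close>
  define m where "m x = max \<bar>u x\<bar> k" for x
  define V where "V = box_vol n lo up"
  define Y where "Y = Lr_norm n h (\<rho> * p) Om u powr p"
  define M where "M = Cs * sqrt 2 * A powr (1 / 2)"
  have q'1: "q' > 1" using q by (simp add: q')
  have conj: "1 / q + 1 / q' = 1" using q by (simp add: q' field_simps)
  have "1 * 1 \<le> q' * p"
    using q'1 p by (intro mult_mono) auto
  then have r1: "r \<ge> 1" by (simp add: r_def)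
  have V0: "V \<ge> 0" "real (card Om) * H \<le> V"
    using volume_open H_pos order_trans[of 0 "real (card Om) * H"] by (auto simp: V_def)
  have N0: "N \<ge> 0" using N(1) Lr_norm_nonneg order_trans by blast
  have A0: "A \<ge> 0" by (simp add: A)
  have m0: "m x \<ge> 0" for x by (simp add: m_def)
  have "(\<Sum>x\<in>Om. m x powr r * H) \<le> (\<Sum>x\<in>Om. \<bar>u x\<bar> powr r * H + k powr r * H)"
    using H_pos by (intro sum_mono) (auto simp: m_def max_def)
  also have "\<dots> = Lr_norm n h r Om u powr r + k powr r * (real (card Om) * H)"
    using r1 by (simp add: Lr_norm_powr sum.distrib)
  also have "\<dots> \<le> N powr r + N powr r"
  proof (intro add_mono)
    show "Lr_norm n h r Om u powr r \<le> N powr r"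
      using N(1)[folded r_def] r1 by (intro powr_mono2) auto
    \<comment> \<open>The base \<open>1 + V\<close> is at least 1, unlike \<open>V\<close>, so the
      exponent may be raised from 1 to \<open>r\<close>.\<close>
    have "real (card Om) * H \<le> (1 + V) powr 1" using V0 by simp
    also have "\<dots> \<le> (1 + V) powr r" using V0 r1 by (intro powr_mono) auto
    finally have "k powr r * (real (card Om) * H) \<le> k powr r * (1 + V) powr r"
      by (intro mult_left_mono) auto
    also have "\<dots> = (k * (1 + V)) powr r" by (simp add: powr_mult)
    also have "\<dots> \<le> N powr r"
      using N(2) k V0 r1 by (intro powr_mono2) (auto simp: V_def)
    finally show "k powr r * (real (card Om) * H) \<le> N powr r" .
  qed
  finally have mr: "(\<Sum>x\<in>Om. m x powr r * H) \<le> 2 * N powr r" by simp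
  have "(\<Sum>x\<in>Om. (\<bar>a x\<bar> * \<bar>u x\<bar> + \<bar>b x\<bar>) * \<bar>u x\<bar> powr (2 * p - 1) * H)
      \<le> (\<Sum>x\<in>Om. ((\<bar>a x\<bar> + 1) powr q * H) powr (1 / q) * (m x powr r * H) powr (1 / q'))"
  proof (intro sum_mono)
    fix x assume x: "x \<in> Om"
    have "(\<bar>a x\<bar> * \<bar>u x\<bar> + \<bar>b x\<bar>) * \<bar>u x\<bar> powr (2 * p - 1) \<le> (\<bar>a x\<bar> * m x + m x) * m x powr (2 * p - 1)"
      using k(2)[OF x] p by (intro mult_mono add_mono powr_mono2 mult_left_mono) (auto simp: m_def)
    also have "\<dots> = (\<bar>a x\<bar> + 1) * (m x * m x powr (2 * p - 1))"
      by (simp add: algebra_simps)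
    also have "m x * m x powr (2 * p - 1) = m x powr (2 * p)"
      using m0 by (simp add: powr_mult_base)
    finally have "(\<bar>a x\<bar> * \<bar>u x\<bar> + \<bar>b x\<bar>) * \<bar>u x\<bar> powr (2 * p - 1) * H \<le> (\<bar>a x\<bar> + 1) * m x powr (2 * p) * H"
      using H_pos by (intro mult_right_mono) auto
    also have "\<dots> = ((\<bar>a x\<bar> + 1) powr q) powr (1 / q) * (m x powr r) powr (1 / q') * (H powr (1 / q + 1 / q'))"
      using q q'1 H_pos conj by (simp add: powr_powr r_def)
    also have "\<dots> = ((\<bar>a x\<bar> + 1) powr q * H) powr (1 / q) * (m x powr r * H) powr (1 / q')"
      by (simp only: powr_mult powr_add mult_ac)
    finally show "(\<bar>a x\<bar> * \<bar>u x\<bar> + \<bar>b x\<bar>) * \<bar>u x\<bar> powr (2 * p - 1) * H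
      \<le> ((\<bar>a x\<bar> + 1) powr q * H) powr (1 / q) * (m x powr r * H) powr (1 / q')" .
  qed
  also have "\<dots> \<le> (\<Sum>x\<in>Om. (\<bar>a x\<bar> + 1) powr q * H) powr (1 / q) * (\<Sum>x\<in>Om. m x powr r * H) powr (1 / q')"
    using q q'1 conj H_pos finite_open by (intro Hoelder_sum) auto
  also have "\<dots> \<le> A * (2 * N powr r) powr (1 / q')"
  proof (intro mult_mono powr_mono2 mr)
    show "(\<Sum>x\<in>Om. (\<bar>a x\<bar> + 1) powr q * H) powr (1 / q) \<le> A"
      by (simp add: A Lr_norm_def)
  qed (use q'1 H_pos A0 in \<open>auto intro!: sum_nonneg\<close>)
  also have "(2 * N powr r) powr (1 / q') = 2 powr (1 / q') * (N powr p)\<^sup>2"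
  proof -
    have "(N powr r) powr (1 / q') = N powr (p + p)"
      using q'1 by (simp add: powr_powr r_def)
    then show ?thesis
      by (simp only: powr_mult powr_add power2_eq_square)
  qed
  \<comment> \<open>The factor 2 comes from the two summands in \<open>mr\<close>; its root is the
    \<open>sqrt 2\<close> of the conclusion.\<close>
  also have "A * (2 powr (1 / q') * (N powr p)\<^sup>2) \<le> A * (2 * (N powr p)\<^sup>2)"
    using A0 q'1 powr_mono[of "1 / q'" 1 2] by (intro mult_left_mono mult_right_mono) auto
  finally have int: "(\<Sum>x\<in>Om. (\<bar>a x\<bar> * \<bar>u x\<bar> + \<bar>b x\<bar>) * \<bar>u x\<bar> powr (2 * p - 1) * H) \<le> A * (2 * (N powr p)\<^sup>2)" .
  have Y: "Y \<le> Cs * D_norm n lo up h (\<lambda>x. \<bar>u x\<bar> powr p)"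
  proof -
    have "(\<Sum>x\<in>C. (\<bar>u x\<bar> powr p) powr \<rho> * H) = (\<Sum>x\<in>Om. \<bar>u x\<bar> powr (\<rho> * p) * H)"
      using u by (subst sum_closed_open) (auto simp: W012_iff powr_powr mult.commute)
    then have "(\<Sum>x\<in>C. (\<bar>u x\<bar> powr p) powr \<rho> * H) powr (1 / \<rho>) = Y"
      using p \<rho> by (simp add: Y_def Lr_norm_def powr_powr)
    moreover have "W012 n lo up h (\<lambda>x. \<bar>u x\<bar> powr p)"
      using u by (simp add: W012_def)
    ultimately show ?thesis
      using Sob[of "\<lambda>x. \<bar>u x\<bar> powr p"] by simp
  qed
  have "Y\<^sup>2 \<le> (Cs * D_norm n lo up h (\<lambda>x. \<bar>u x\<bar> powr p))\<^sup>2"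
    using Y by (intro power_mono) (auto simp: Y_def)
  also have "\<dots> \<le> Cs\<^sup>2 * (p * (A * (2 * (N powr p)\<^sup>2)))"
    unfolding power_mult_distrib
  proof (intro mult_left_mono)
    show "(D_norm n lo up h (\<lambda>x. \<bar>u x\<bar> powr p))\<^sup>2 \<le> p * (A * (2 * (N powr p)\<^sup>2))"
      using p by (intro order_trans[OF energy_estimate[OF u eq p] mult_left_mono[OF int]]) auto
  qed auto
  \<comment> \<open>Enlarging \<open>p\<close> to its square yields a perfect square.\<close>
  also have "\<dots> \<le> Cs\<^sup>2 * (p\<^sup>2 * (A * (2 * (N powr p)\<^sup>2)))"
    using p A0 by (intro mult_left_mono mult_right_mono) (auto simp: power2_eq_square)
  also have "\<dots> = (M * p * N powr p)\<^sup>2"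
    using A0 by (simp add: M_def power_mult_distrib powr_half_sqrt mult_ac)
  finally have "Y \<le> M * p * N powr p"
    using Cs p by (intro power2_le_imp_le[of Y]) (auto simp: M_def)
  then have "Y powr (1 / p) \<le> (M * p * N powr p) powr (1 / p)"
    using p by (intro powr_mono2) (auto simp: Y_def)
  also have "\<dots> = (M * p) powr (1 / p) * N"
    using p N0 by (simp add: powr_mult powr_powr)
  finally show ?thesis
    using p by (simp add: Y_def M_def powr_powr)
qed

text \<open>A single summand already gives
  \<open>\<bar>u x\<bar> * H powr (1 / r j) \<le> B\<close>, and the power of \<open>H\<close> tends
  to 1.\<close>

lemma abs_le_of_Lr_norm_bounded:
  assumes x: "x \<in> Om" and r: "\<And>j. r j > 0" "filterlim r at_top sequentially"
    and B: "\<And>j. Lr_norm n h (r j) Om u \<le> B"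
  shows "\<bar>u x\<bar> \<le> B"
proof -
  have "\<bar>u x\<bar> * H powr (1 / r j) \<le> B" for j
  proof -
    have "\<bar>u x\<bar> powr r j * H \<le> (\<Sum>y\<in>Om. \<bar>u y\<bar> powr r j * H)"
      using x finite_open H_pos by (intro member_le_sum) auto
    then have "(\<bar>u x\<bar> powr r j * H) powr (1 / r j) \<le> Lr_norm n h (r j) Om u"
      unfolding Lr_norm_def using r(1)[of j] H_pos by (intro powr_mono2) auto
    moreover have "(\<bar>u x\<bar> powr r j * H) powr (1 / r j) = \<bar>u x\<bar> * H powr (1 / r j)"
      using r(1)[of j] by (simp add: powr_mult powr_powr)
    ultimately show ?thesis using B[of j] by linarith
  qed
  moreover have "(\<lambda>j. \<bar>u x\<bar> * H powr (1 / r j)) \<longlonglongrightarrow> \<bar>u x\<bar> * H powr 0"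
    using H_pos r(2) by (intro tendsto_intros real_tendsto_divide_at_top) auto
  ultimately show ?thesis
    using H_pos by (intro LIMSEQ_le_const2[where x = "\<bar>u x\<bar>"]) auto
qed

text \<open>\<open>Moser_step\<close> is iterated with \<open>p = \<chi> ^ j\<close>; since
  \<open>\<rho> = 2 * q' * \<chi>\<close>, the exponent reached in one step is the starting exponent
  of the next.\<close>

lemma Moser_sup_bound:
  assumes u: "W012 n lo up h u"
    and eq: "\<And>x. x \<in> Om \<Longrightarrow> - disc_laplace n h u x = a x * u x + b x"
    and Sob: "\<And>f. W012 n lo up h f \<Longrightarrow> (\<And>x. f x \<ge> 0) \<Longrightarrow>
      (\<Sum>x\<in>C. f x powr \<rho> * H) powr (1 / \<rho>) \<le> Cs * D_norm n lo up h f"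
    and Cs: "Cs \<ge> 0" and q: "q > 1" and q': "q' = q / (q - 1)"
    and \<chi>: "\<chi> > 1" "\<rho> = 2 * q' * \<chi>"
    and K: "K = max \<chi> (Cs * sqrt 2 * Lr_norm n h q Om (\<lambda>x. \<bar>a x\<bar> + 1) powr (1 / 2))
      powr ((\<chi> / (\<chi> - 1))\<^sup>2)"
    and k: "k \<ge> 0" "\<And>x. x \<in> Om \<Longrightarrow> \<bar>b x\<bar> \<le> k" and x: "x \<in> Om"
  shows "\<bar>u x\<bar> \<le> K * max (Lr_norm n h (2 * q') Om u) (k * (1 + box_vol n lo up))"
proof -
  define A where "A = Lr_norm n h q Om (\<lambda>x. \<bar>a x\<bar> + 1)"
  define m where "m = max \<chi> (Cs * sqrt 2 * A powr (1 / 2))"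
  define P where "P j = (\<Prod>i<j. (m * \<chi> ^ i) powr (1 / \<chi> ^ i))" for j
  define N where "N = max (Lr_norm n h (2 * q') Om u) (k * (1 + box_vol n lo up))"
  have q'0: "q' > 0" using q by (simp add: q')
  have m: "m \<ge> \<chi>" by (simp add: m_def)
  have N0: "N \<ge> 0" by (simp add: N_def le_max_iff_disj)
  have \<chi>j: "\<chi> ^ j \<ge> 1" for j using \<chi> by simp
  \<comment> \<open>This keeps the source bound \<open>k * (1 + box_vol n lo up)\<close> below
    \<open>P j * N\<close>, as every further step requires.\<close>
  have P1: "P j \<ge> 1" for j
    unfolding P_def
  proof (intro prod_ge_1)
    fix i
    have "1 * 1 \<le> m * \<chi> ^ i" using \<chi>j m \<chi> by (intro mult_mono) auto
    then show "1 \<le> (m * \<chi> ^ i) powr (1 / \<chi> ^ i)"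
      using \<chi>j[of i] \<chi> by (intro ge_one_powr_ge_zero) auto
  qed
  have iter: "Lr_norm n h (2 * q' * \<chi> ^ j) Om u \<le> P j * N" for j
  proof (induction j)
    case 0
    then show ?case by (simp add: P_def N_def)
  next
    case (Suc j)
    have "1 * N \<le> P j * N" using P1 N0 by (intro mult_right_mono) auto
    moreover have "k * (1 + box_vol n lo up) \<le> N" by (simp add: N_def)
    ultimately have "k * (1 + box_vol n lo up) \<le> P j * N" by linarith
    moreover have "\<rho> > 0" using \<chi> q'0 by simp
    ultimately have "Lr_norm n h (\<rho> * \<chi> ^ j) Om u
        \<le> (Cs * sqrt 2 * A powr (1 / 2) * \<chi> ^ j) powr (1 / \<chi> ^ j) * (P j * N)"
      by (intro Moser_step[OF u eq Sob Cs _ q q' \<chi>j A_def k Suc])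
    also have "\<dots> \<le> (m * \<chi> ^ j) powr (1 / \<chi> ^ j) * (P j * N)"
      using Cs \<chi> P1[of j] N0 by (intro mult_right_mono powr_mono2) (auto simp: m_def)
    also have "\<dots> = P (Suc j) * N" by (simp add: P_def mult_ac)
    finally show ?case by (simp add: \<chi> mult_ac)
  qed
  have "P j \<le> K" for j
    using prod_powr_geometric_le[OF \<chi>(1) m, of j] by (simp add: P_def K m_def A_def)
  then have "Lr_norm n h (2 * q' * \<chi> ^ j) Om u \<le> K * N" for j
    using iter[of j] N0 by (meson mult_right_mono order_trans)
  moreover have "filterlim (\<lambda>j. 2 * q' * \<chi> ^ j) at_top sequentially"
    using q'0 \<chi> by (intro filterlim_tendsto_pos_mult_at_top[OF tendsto_const]
        filterlim_at_infinity_imp_filterlim_at_top filterlim_realpow_sequentially_gt1) auto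
  ultimately show ?thesis
    using q'0 \<chi> unfolding N_def[symmetric]
    by (intro abs_le_of_Lr_norm_bounded[OF x, where r = "\<lambda>j. 2 * q' * \<chi> ^ j"]) auto
qed

text \<open>The starting norm still contains the maximum norm \<open>s\<close>, but only to the
  power \<open>1 / q < 1\<close>, so \<open>s\<close> can be absorbed on the left. If the maximum is
  attained by the source term, the bound is immediate.\<close>

lemma Moser_bound:
  assumes u: "W012 n lo up h u"
    and eq: "\<And>x. x \<in> Om \<Longrightarrow> - disc_laplace n h u x = a x * u x + b x"
    and Sob: "\<And>f. W012 n lo up h f \<Longrightarrow> (\<And>x. f x \<ge> 0) \<Longrightarrow>
      (\<Sum>x\<in>C. f x powr \<rho> * H) powr (1 / \<rho>) \<le> Cs * D_norm n lo up h f"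
    and Cs: "Cs \<ge> 0" and q: "q > 1" and q': "q' = q / (q - 1)"
    and \<chi>: "\<chi> > 1" "\<rho> = 2 * q' * \<chi>"
    and K: "K = max \<chi> (Cs * sqrt 2 * Lr_norm n h q Om (\<lambda>x. \<bar>a x\<bar> + 1) powr (1 / 2))
      powr ((\<chi> / (\<chi> - 1))\<^sup>2)"
  shows "sup_norm C u \<le> (2 * K) powr q' * Lr_norm n h 2 C u
    + 2 * K * sup_norm Om b * (1 + box_vol n lo up)"
proof -
  define s where "s = sup_norm C u"
  define y where "y = Lr_norm n h 2 C u"
  define k where "k = sup_norm Om b"
  define V where "V = box_vol n lo up"
  have us: "\<bar>u x\<bar> \<le> s" if "x \<in> C" for x
    using that finite_closed by (simp add: s_def sup_norm_def)
  have bk: "\<bar>b x\<bar> \<le> k" if "x \<in> Om" for x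
    using that finite_open by (simp add: k_def sup_norm_def)
  have k0: "k \<ge> 0"
    using open_nonempty bk abs_ge_zero order_trans by blast
  have s0: "s \<ge> 0"
    using open_nonempty open_subset us abs_ge_zero order_trans by blast
  have V0: "V \<ge> 0"
    using volume_open H_pos order_trans[of 0 "real (card Om) * H"] by (auto simp: V_def)
  have K0: "K \<ge> 0" by (simp add: K)
  have q'1: "q' > 1" using q by (simp add: q')
  have y0: "y \<ge> 0" by (simp add: y_def)
  have norm2q: "Lr_norm n h (2 * q') Om u \<le> s powr (1 / q) * y powr (1 / q')"
  proof -
    have "(\<Sum>x\<in>Om. \<bar>u x\<bar> powr (2 * q') * H) \<le> (\<Sum>x\<in>Om. s powr (2 * q' - 2) * (\<bar>u x\<bar> powr 2 * H))"
    proof (intro sum_mono)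
      fix x assume "x \<in> Om"
      then have "\<bar>u x\<bar> \<le> s" using us open_subset by blast
      then have "\<bar>u x\<bar> powr (2 * q' - 2) \<le> s powr (2 * q' - 2)"
        using q'1 by (intro powr_mono2) auto
      then have "\<bar>u x\<bar> powr (2 * q' - 2) * (\<bar>u x\<bar> powr 2 * H) \<le> s powr (2 * q' - 2) * (\<bar>u x\<bar> powr 2 * H)"
        using H_pos by (intro mult_right_mono) auto
      moreover have "\<bar>u x\<bar> powr (2 * q') = \<bar>u x\<bar> powr (2 * q' - 2) * \<bar>u x\<bar> powr 2"
        by (simp only: powr_add[symmetric]) simp
      ultimately show "\<bar>u x\<bar> powr (2 * q') * H \<le> s powr (2 * q' - 2) * (\<bar>u x\<bar> powr 2 * H)"
        by (simp only: mult.assoc)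
    qed
    also have "\<dots> = s powr (2 * q' - 2) * (\<Sum>x\<in>Om. \<bar>u x\<bar> powr 2 * H)"
      by (simp only: sum_distrib_left)
    also have "(\<Sum>x\<in>Om. \<bar>u x\<bar> powr 2 * H) = (\<Sum>x\<in>C. \<bar>u x\<bar> powr 2 * H)"
      using u by (intro sum_closed_open[symmetric]) (auto simp: W012_iff)
    also have "\<dots> = y powr 2"
      unfolding y_def by (rule Lr_norm_powr[symmetric]) simp
    finally have "Lr_norm n h (2 * q') Om u \<le> (s powr (2 * q' - 2) * y powr 2) powr (1 / (2 * q'))"
      unfolding Lr_norm_def using q'1 H_pos by (intro powr_mono2 sum_nonneg) auto
    also have "\<dots> = s powr ((2 * q' - 2) / (2 * q')) * y powr (2 / (2 * q'))"
      by (simp only: powr_mult powr_powr times_divide_eq_right mult_1_right)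
    also have "(2 * q' - 2) / (2 * q') = 1 / q"
      using q by (simp add: q' field_simps)
    finally show ?thesis by simp
  qed
  have "\<bar>u x\<bar> \<le> K * max (Lr_norm n h (2 * q') Om u) (k * (1 + V))" if x: "x \<in> Om" for x
    unfolding V_def by (rule Moser_sup_bound[OF u eq Sob Cs q q' \<chi> K k0 bk x])
  moreover have "0 \<le> K * max (Lr_norm n h (2 * q') Om u) (k * (1 + V))"
    using K0 by (simp add: le_max_iff_disj)
  ultimately have "\<bar>u x\<bar> \<le> K * max (Lr_norm n h (2 * q') Om u) (k * (1 + V))" if "x \<in> C" for x
    using u that by (cases "x \<in> Om") (auto simp: W012_iff)
  then have sup: "s \<le> K * max (Lr_norm n h (2 * q') Om u) (k * (1 + V))"
    unfolding s_def sup_norm_def using open_nonempty open_subset finite_closed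
    by (intro Max.boundedI) auto
  have kV: "0 \<le> K * (k * (1 + V))" using K0 k0 V0 by simp
  have Ky: "0 \<le> (2 * K) powr q' * y" using y0 by simp
  show ?thesis
  proof (cases "Lr_norm n h (2 * q') Om u \<le> k * (1 + V)")
    case True
    then have "s \<le> K * (k * (1 + V))" using sup by (simp add: max_def)
    then show ?thesis
      using kV Ky unfolding s_def[symmetric] y_def[symmetric] k_def[symmetric] V_def[symmetric]
      by (simp add: mult.assoc)
  next
    case False
    then have "s \<le> K * Lr_norm n h (2 * q') Om u" using sup by (simp add: max_def)
    also have "\<dots> \<le> K * (s powr (1 / q) * y powr (1 / q'))"
      using norm2q K0 by (intro mult_left_mono)
    finally have le: "s \<le> K * y powr (1 / q') * s powr (1 / q)" by (simp add: mult_ac)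
    \<comment> \<open>Cancelling \<open>s powr (1 / q)\<close> leaves
      \<open>s powr (1 / q')\<close>; raising to the power \<open>q'\<close> produces the exponent
      of \<open>K\<close>.\<close>
    have "s \<le> K powr q' * y"
    proof (cases "s = 0")
      case True
      then show ?thesis using y0 by simp
    next
      case False
      with s0 have s: "s > 0" by simp
      have "1 / q' + 1 / q = 1" using q by (simp add: q' field_simps)
      then have "s powr (1 / q') * s powr (1 / q) = s"
        using s by (simp flip: powr_add)
      with le have "s powr (1 / q') * s powr (1 / q) \<le> K * y powr (1 / q') * s powr (1 / q)" by simp
      then have "s powr (1 / q') \<le> K * y powr (1 / q')" using s by simp
      then have "(s powr (1 / q')) powr q' \<le> (K * y powr (1 / q')) powr q'"
        using q'1 by (intro powr_mono2) auto
      then show ?thesis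
        using s y0 q'1 by (simp add: powr_powr powr_mult)
    qed
    also have "\<dots> \<le> (2 * K) powr q' * y"
      using K0 y0 q'1 by (intro mult_right_mono powr_mono2) auto
    finally show ?thesis
      using kV unfolding s_def[symmetric] y_def[symmetric] k_def[symmetric] V_def[symmetric]
      by (simp add: mult.assoc)
  qed
qed

end

text \<open>\<open>\<chi>\<close> is the quotient of the Sobolev exponent
  \<open>2 * d / (d - 2)\<close> by \<open>2 * q'\<close>. It exceeds 1 because
  \<open>q > d / 2\<close>, and the last identity matches the exponent in \<open>K\<close>. A real
  \<open>d\<close> covers both the dimension and the substitute \<open>nh\<close>.\<close>

lemma Moser_ratio:
  fixes d q q' \<chi> :: real
  assumes "d > 2" "q > d / 2" "q' = q / (q - 1)" "\<chi> = d / ((d - 2) * q')"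
  shows "\<chi> > 1" "2 * q' * \<chi> = 2 * d / (d - 2)" "\<chi> / (\<chi> - 1) = d * (q - 1) / (2 * q - d)"
proof -
  have \<chi>: "\<chi> = d * (q - 1) / ((d - 2) * q)"
    using assms by simp
  have "q > 0" using assms by linarith
  then have pos: "(d - 2) * q > 0" using assms by simp
  have diff: "\<chi> - 1 = (2 * q - d) / ((d - 2) * q)"
  proof -
    have "d * (q - 1) - (d - 2) * q = 2 * q - d" by (simp add: algebra_simps)
    moreover have "\<chi> - 1 = (d * (q - 1) - (d - 2) * q) / ((d - 2) * q)"
      using \<open>q > 0\<close> assms(1) by (simp add: \<chi> diff_divide_distrib)
    ultimately show ?thesis by simp
  qed
  then have "\<chi> - 1 > 0" using pos assms by simp
  then show "\<chi> > 1" by simp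
  show "2 * q' * \<chi> = 2 * d / (d - 2)"
    using assms by simp
  show "\<chi> / (\<chi> - 1) = d * (q - 1) / (2 * q - d)"
    unfolding diff unfolding \<chi> using \<open>q > 0\<close> assms(1) by simp
qed

theorem mainTheorem13:
  fixes n :: nat and lo up h :: "nat \<Rightarrow> real"
    and a b u :: "pt \<Rightarrow> real" and q nh CP K :: real
  assumes n2: "n \<ge> 2"
    and mesh: "admissible_mesh n lo up h"
    and u0: "W012 n lo up h u"
    and eq: "\<forall>x\<in>open_grid n lo up h. - disc_laplace n h u x = a x * u x + b x"
    and CP: "is_poincare_const n lo up h CP"
    and q: "q > real n / 2"
    and nh: "n = 2 \<longrightarrow> q > nh / 2 \<and> nh / 2 > 1"
    and K: "K = (let q' = q / (q - 1);
                     A = Lr_norm n h q (open_grid n lo up h) (\<lambda>x. \<bar>a x\<bar> + 1)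
                 in if n \<ge> 3 then
                   max (real n / ((real n - 2) * q')) (C_S n * sqrt 2 * A powr (1/2))
                     powr ((real n * (q - 1) / (2 * q - real n))^2)
                 else
                   max (nh / ((nh - 2) * q'))
                       (4 * nh / (nh - 2) * C_S 2 * (1 + CP) * sqrt 2 * A powr (1/2))
                     powr ((nh * (q - 1) / (2 * q - nh))^2))"
  shows "sup_norm (closed_grid n lo up h) u
           \<le> (2 * K) powr (q / (q - 1)) * Lr_norm n h 2 (closed_grid n lo up h) u
             + 2 * K * sup_norm (open_grid n lo up h) b * (1 + box_vol n lo up)"
proof -
  interpret box_mesh n lo up h by (unfold_locales) (rule mesh)
  define q' where "q' = q / (q - 1)"
  have q1: "q > 1" using q n2 by linarith
  show ?thesis
  proof (cases "n \<ge> 3")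
    case True
    define \<rho> where "\<rho> = 2 * real n / (real n - 2)"
    define \<chi> where "\<chi> = real n / ((real n - 2) * q')"
    have "real n > 2" using True by simp
    note ratio = Moser_ratio[OF this q q'_def \<chi>_def]
    have Sob: "(\<Sum>x\<in>C. f x powr \<rho> * H) powr (1 / \<rho>) \<le> C_S n * D_norm n lo up h f"
      if "W012 n lo up h f" "\<And>x. f x \<ge> 0" for f
      using Sobolev_high_dim[OF True that \<rho>_def] .
    have "C_S n \<ge> 0" using True by (simp add: C_S_def)
    moreover have "\<rho> = 2 * q' * \<chi>" using ratio(2) by (simp add: \<rho>_def)
    ultimately show ?thesis
      unfolding q'_def[symmetric] using eq K True ratio q1
      by (intro Moser_bound[OF u0 _ Sob, where \<chi> = \<chi>]) (auto simp: Let_def q'_def \<chi>_def)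
  next
    case False
    with n2 have n: "n = 2" by simp
    with nh have nh2: "nh > 2" "q > nh / 2" by auto
    \<comment> \<open>In the plane every finite exponent above 2 is available, so \<open>nh\<close>
      takes the place of the dimension.\<close>
    define \<rho> where "\<rho> = 2 * nh / (nh - 2)"
    define \<chi> where "\<chi> = nh / ((nh - 2) * q')"
    define Cs where "Cs = 4 * nh / (nh - 2) * C_S 2 * (1 + CP)"
    note ratio = Moser_ratio[OF nh2 q'_def \<chi>_def]
    have CP0: "CP > 0" using Poincare_const_pos[OF CP] .
    have \<rho>: "\<rho> > 2" using nh2 by (simp add: \<rho>_def field_simps)
    have CS: "C_S 2 \<ge> 1"
    proof -
      have "1 * 1 \<le> 2 * pi * (exp 1 + 256)"
        using pi_ge_two by (intro mult_mono) (auto intro: add_nonneg_pos order_trans[of 1 256])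
      then have "1 \<le> sqrt (2 * pi * (exp 1 + 256))" by simp
      moreover have "C_S 2 = 8 * sqrt (2 * pi * (exp 1 + 256))" by (simp add: C_S_def)
      ultimately show ?thesis by linarith
    qed
    \<comment> \<open>The constant from \<open>Sobolev_dim_two\<close> is fitted under the stated
      one by \<open>2 * nh - 2 \<le> 4 * nh\<close> and \<open>C_S 2 \<ge> 1\<close>.\<close>
    have le: "(\<rho> / 2 + 1) * (1 + CP) \<le> Cs"
    proof -
      have "\<rho> / 2 + 1 = (2 * nh - 2) / (nh - 2)" using nh2 by (simp add: \<rho>_def field_simps)
      also have "\<dots> \<le> 4 * nh / (nh - 2)" using nh2 by (intro divide_right_mono) auto
      also have "\<dots> \<le> 4 * nh / (nh - 2) * C_S 2"
        using CS nh2 mult_left_mono[of 1 "C_S 2" "4 * nh / (nh - 2)"] by simp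
      finally show ?thesis
        unfolding Cs_def using CP0 by (intro mult_right_mono) auto
    qed
    have Sob: "(\<Sum>x\<in>C. f x powr \<rho> * H) powr (1 / \<rho>) \<le> Cs * D_norm n lo up h f"
      if "W012 n lo up h f" "\<And>x. f x \<ge> 0" for f
      using Sobolev_dim_two[OF n that \<rho> CP] mult_right_mono[OF le D_norm_nonneg, of f] by linarith
    have "Cs \<ge> 0" using CS nh2 CP0 by (simp add: Cs_def)
    moreover have "\<rho> = 2 * q' * \<chi>" using ratio(2) by (simp add: \<rho>_def)
    ultimately show ?thesis
      unfolding q'_def[symmetric] using eq K False ratio q1
      by (intro Moser_bound[OF u0 _ Sob, where \<chi> = \<chi>]) (auto simp: Let_def q'_def \<chi>_def Cs_def)
  qed
qed

end
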